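(* Let $d,r\in\mathbb{N}$, let $a\in(l_0(\mathbb{Z}^d))^{r\times r}$ be a finitely supported matrix mask and let $v\in(l_0(\mathbb{Z}^d))^{1\times r}$ be a finitely supported sequence with $\widehat{v}(0)\ne0$. For $m\in\mathbb{N}_0$, the following are equivalent to each other: (1) $\mathcal{S}_a\mathscr{P}_{m,v}=\mathscr{P}_{m,v}$ and $\mathcal{S}_a(\widehat{v}(0))=\widehat{v}(0)$, where $\widehat{v}(0)$ is regarded as a constant sequence on $\mathbb{Z}^d$. (2) There exists a finitely supported sequence $c\in l_0(\mathbb{Z}^d)$ with $\widehat{c}(0)=1$ such that, as $\xi\to0$, $$\widehat{v}(2\xi)\widehat{a}(\xi)=\widehat{c}(\xi)\widehat{v}(\xi)+\mathscr{O}(\|\xi\|^{m+1})\quad\text{and}\quad\widehat{v}(2\xi)\widehat{a}(\xi+\pi\omega)=\mathscr{O}(\|\xi\|^{m+1}),\quad\forall\,\omega\in\Gamma\setminus\{0\}.$$ (3) There exists a finitely supported sequence $b\in l_0(\mathbb{Z}^d)$ with $\widehat{b}(0)=1$ such that, with $\upsilon_a:=b*v$, the mask $a$ has order $m+1$ sum rules with the matching filter $\upsilon_a\in(l_0(\mathbb{Z}^d))^{1\times r}$. (4) $\mathcal{S}_a\mathsf{p}_\mu=2^{-|\mu|}\mathsf{p}_\mu$ for all $\mu\in\mathbb{N}_0^d$ with $|\mu|\le m$, where $$\mathsf{p}_\mu(x):=\left(\frac{(\cdot)^\mu}{\mu!}*\upsilon_a\right)(x)=\sum_{0\le\nu\le\mu}\frac{(-i)^{|\nu|}}{\nu!(\mu-\nu)!}x^{\mu-\nu}\widehat{\upsilon_a}^{(\nu)}(0),\qquad\mu\in\mathbb{N}_0^d,$$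 and $\upsilon_a=b*v$ for some $b\in l_0(\mathbb{Z}^d)$ with $\widehat{b}(0)=1$, as given in item (3). (5) For every $\mu\in\mathbb{N}_0^d$ with $|\mu|=m$, there exists $\mathsf{q}_\mu\in(\Pi_m)^{1\times r}$ such that $\mathcal{S}_a\mathsf{q}_\mu=2^{-|\mu|}\mathsf{q}_\mu$ and $$\operatorname{span}\{\mathsf{q}_\mu^{(\nu)}:\mu,\nu\in\mathbb{N}_0^d,\ |\mu|=m\}=\mathscr{P}_{m,v}.$$ (6) $\mathcal{S}_a\widehat{v}(0)=\widehat{v}(0)$ and $\mathcal{S}_a\big(\frac{(\cdot)^\mu}{\mu!}*v\big)\in\mathscr{P}_{m,v}$ for all $\mu\in\mathbb{N}_0^d$ with $|\mu|=m$. Moreover, any one of the six equivalent items (1)--(6) implies that, with $\upsilon_a$ given in item (3), for all $\mathsf{p}\in\Pi_m$, $$\mathcal{S}_a(\mathsf{p}*v)=((\mathsf{p}*v)(2^{-1}\cdot))*a=(\mathsf{p}(2^{-1}\cdot))*\mathring{v},\qquad\mathcal{S}_a(\mathsf{p}*\upsilon_a)=((\mathsf{p}*\upsilon_a)(2^{-1}\cdot))*a=(\mathsf{p}(2^{-1}\cdot))*\upsilon_a,$$ with $\widehat{\mathring{v}}(\xi):=\widehat{v}(2\xi)\widehat{a}(\xi)$, and $$[\mathcal{S}_a(\mathsf{p}*v)]^{(\nu)}=2^{-|\nu|}\mathcal{S}_a(\mathsf{p}^{(\nu)}*v),\qquad[\mathcal{S}_a(\mathsf{p}*\upsilon_a)]^{(\nu)}=2^{-|\nu|}\mathcal{S}_a(\mathsf{p}^{(\nu)}*\upsilon_a),\qquad\forall\,\mathsf{p}\in\Pi_m,\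 \nu\in\mathbb{N}_0^d.$$
   Context: Notation. $\mathbb{N}_0=\mathbb{N}\cup\{0\}$. $(l(\mathbb{Z}^d))^{s\times r}$ is the space of all sequences $u:\mathbb{Z}^d\to\mathbb{C}^{s\times r}$; $(l_0(\mathbb{Z}^d))^{s\times r}$ the finitely supported ones ($l_0(\mathbb{Z}^d)$ for $s=r=1$), with $\widehat{u}(\xi):=\sum_{k\in\mathbb{Z}^d}u(k)e^{-ik\cdot\xi}$. Usual multi-index notation; $f^{(\mu)}:=\partial^\mu f$; $\nu\le\mu$ means all entries of $\mu-\nu$ are nonnegative. $\Gamma:=[0,1]^d\cap\mathbb{Z}^d=\{0,1\}^d$. "$f(\xi)=g(\xi)+\mathscr{O}(\|\xi\|^{m+1})$, $\xi\to0$" means $f^{(\mu)}(0)=g^{(\mu)}(0)$ for all $|\mu|\le m$. $\Pi_m$ is the space of $d$-variate polynomials of total degree at most $m$ and $(\Pi_m)^{1\times r}$ the space of $1\times r$ row vectors of such polynomials. A polynomial on $\mathbb{R}^d$ is identified with its restriction to $\mathbb{Z}^d$ (which determines it); in particular, when a sequence such as $\mathcal{S}_a\vec{\mathsf{p}}$ is a (vector) polynomial sequence, it is identified with the corresponding polynomial, and its derivatives are understood accordingly. Convolutions: $\mathsf{p}*w:=\sum_{k\in\mathbb{Z}^d}\mathsf{p}(\cdot-k)w(k)$ for a (row vector) polynomial $\mathsf{p}$ and a finitely supported (scalar, vector or matrix) sequence $w$ of compatible size; $b*v:=\sum_kb(\cdot-k)v(k)$ for sequences, so that $\widehat{b*v}=\widehat{b}\,\widehat{v}$.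 $\mathscr{P}_{m,v}:=\{\mathsf{p}*v:\mathsf{p}\in\Pi_m\}$. Subdivision operator: $(\mathcal{S}_au)(j):=2^d\sum_{k\in\mathbb{Z}^d}u(k)a(j-2k)$, $j\in\mathbb{Z}^d$, for $u\in(l(\mathbb{Z}^d))^{s\times r}$. Sum rules: $a$ has order $m+1$ sum rules with a matching filter $\upsilon_a\in(l_0(\mathbb{Z}^d))^{1\times r}$ if $\widehat{\upsilon_a}(0)\ne0$ and, as $\xi\to0$, $\widehat{\upsilon_a}(2\xi)\widehat{a}(\xi)=\widehat{\upsilon_a}(\xi)+\mathscr{O}(\|\xi\|^{m+1})$ and $\widehat{\upsilon_a}(2\xi)\widehat{a}(\xi+\pi\omega)=\mathscr{O}(\|\xi\|^{m+1})$ for all $\omega\in\Gamma\setminus\{0\}$. *)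

theory Defs
  imports "HOL-Analysis.Analysis" "HOL-Library.Function_Algebras"
begin

text \<open>
  The dimension d and the size r are the cardinalities of the index types \<open>'d\<close> and \<open>'r\<close>.
  Sequences on the lattice are functions on \<open>int ^ 'd\<close>, row vectors of length r are elements of
  \<open>complex ^ 'r\<close>, and they act on matrices from the left by \<open>v*\<close>. Polynomials are complex
  polynomial functions on \<open>real ^ 'd\<close>, and multi-indices are elements of \<open>nat ^ 'd\<close>.
\<close>

definition emb :: "int ^ 'd \<Rightarrow> real ^ 'd" where
  "emb k = (\<chi> i. real_of_int (k $ i))"

definition restr :: "(real ^ 'd \<Rightarrow> 'a) \<Rightarrow> int ^ 'd \<Rightarrow> 'a" where
  "restr q = (\<lambda>k. q (emb k))"

definition supp :: "('k \<Rightarrow> 'a::zero) \<Rightarrow> 'k set" where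
  "supp u = {k. u k \<noteq> 0}"

definition Gam :: "(int ^ 'd) set" where
  "Gam = {\<omega>. \<forall>i. \<omega> $ i \<in> {0, 1}}"


section \<open>Multi-indices and partial derivatives\<close>

definition mdeg :: "nat ^ 'd::finite \<Rightarrow> nat" where
  "mdeg \<mu> = (\<Sum>i\<in>UNIV. \<mu> $ i)"

definition mfact :: "nat ^ 'd::finite \<Rightarrow> nat" where
  "mfact \<mu> = (\<Prod>i\<in>UNIV. fact (\<mu> $ i))"

definition mpow :: "real ^ 'd::finite \<Rightarrow> nat ^ 'd \<Rightarrow> complex" where
  "mpow x \<mu> = (\<Prod>i\<in>UNIV. complex_of_real (x $ i) ^ (\<mu> $ i))"

definition partial :: "'d \<Rightarrow> (real ^ 'd::finite \<Rightarrow> 'a::real_normed_vector) \<Rightarrow> real ^ 'd \<Rightarrow> 'a" where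
  "partial i f = (\<lambda>x. vector_derivative (\<lambda>t. f (x + t *\<^sub>R axis i 1)) (at 0))"

text \<open>
  The index type carries no order, so the coordinates are processed along an arbitrary fixed
  enumeration. All functions differentiated here (trigonometric and algebraic polynomials) are
  smooth, hence the choice is immaterial.
\<close>

definition mderiv ::
    "nat ^ 'd::finite \<Rightarrow> (real ^ 'd \<Rightarrow> 'a::real_normed_vector) \<Rightarrow> real ^ 'd \<Rightarrow> 'a" where
  "mderiv \<mu> f = foldr (\<lambda>i. partial i ^^ (\<mu> $ i)) (SOME is. distinct is \<and> set is = UNIV) f"

text \<open>\<open>eq_order n f g\<close> is the relation \<open>f(\<xi>) = g(\<xi>) + O(\<parallel>\<xi>\<parallel>\<^sup>n)\<close> as \<open>\<xi>\<close> tends to 0.\<close>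

definition eq_order ::
    "nat \<Rightarrow> (real ^ 'd::finite \<Rightarrow> 'a::real_normed_vector) \<Rightarrow> (real ^ 'd \<Rightarrow> 'a) \<Rightarrow> bool" where
  "eq_order n f g \<longleftrightarrow> (\<forall>\<mu>. mdeg \<mu> < n \<longrightarrow> mderiv \<mu> f 0 = mderiv \<mu> g 0)"


section \<open>Fourier series of finitely supported scalar, row vector and matrix sequences\<close>

definition fhat :: "(int ^ 'd::finite \<Rightarrow> complex) \<Rightarrow> real ^ 'd \<Rightarrow> complex" where
  "fhat u \<xi> = (\<Sum>k\<in>supp u. u k * exp (- \<i> * complex_of_real (emb k \<bullet> \<xi>)))"

definition vhat :: "(int ^ 'd::finite \<Rightarrow> complex ^ 'r) \<Rightarrow> real ^ 'd \<Rightarrow> complex ^ 'r" where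
  "vhat u \<xi> = (\<chi> j. fhat (\<lambda>k. u k $ j) \<xi>)"

definition mhat :: "(int ^ 'd::finite \<Rightarrow> complex ^ 'r ^ 's) \<Rightarrow> real ^ 'd \<Rightarrow> complex ^ 'r ^ 's" where
  "mhat a \<xi> = (\<chi> i j. fhat (\<lambda>k. a k $ i $ j) \<xi>)"


section \<open>Polynomials and convolutions\<close>

definition Pol :: "nat \<Rightarrow> (real ^ 'd::finite \<Rightarrow> complex) set" where
  "Pol m = {p. \<exists>c. p = (\<lambda>x. \<Sum>\<mu> | mdeg \<mu> \<le> m. c \<mu> * mpow x \<mu>)}"

definition vPol :: "nat \<Rightarrow> (real ^ 'd::finite \<Rightarrow> complex ^ 'r) set" where
  "vPol m = {q. \<forall>j. (\<lambda>x. q x $ j) \<in> Pol m}"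

text \<open>
  A polynomial sequence is the restriction of exactly one polynomial; \<open>pol_ext\<close> recovers it.
\<close>

definition pol_ext :: "(int ^ 'd::finite \<Rightarrow> complex ^ 'r) \<Rightarrow> real ^ 'd \<Rightarrow> complex ^ 'r" where
  "pol_ext u = (THE q. (\<exists>n. q \<in> vPol n) \<and> restr q = u)"

definition conv_pv ::
    "(real ^ 'd::finite \<Rightarrow> complex) \<Rightarrow> (int ^ 'd \<Rightarrow> complex ^ 'r) \<Rightarrow> real ^ 'd \<Rightarrow> complex ^ 'r" where
  "conv_pv p w = (\<lambda>x. \<Sum>k\<in>supp w. p (x - emb k) *s w k)"

definition conv_pm ::
    "(real ^ 'd::finite \<Rightarrow> complex ^ 'r) \<Rightarrow> (int ^ 'd \<Rightarrow> complex ^ 's ^ 'r) \<Rightarrow> real ^ 'd \<Rightarrow> complex ^ 's" where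
  "conv_pm q w = (\<lambda>x. \<Sum>k\<in>supp w. q (x - emb k) v* w k)"

definition conv_sv ::
    "(int ^ 'd::finite \<Rightarrow> complex) \<Rightarrow> (int ^ 'd \<Rightarrow> complex ^ 'r) \<Rightarrow> int ^ 'd \<Rightarrow> complex ^ 'r" where
  "conv_sv b v = (\<lambda>n. \<Sum>k\<in>supp v. b (n - k) *s v k)"

definition PolV :: "nat \<Rightarrow> (int ^ 'd::finite \<Rightarrow> complex ^ 'r) \<Rightarrow> (real ^ 'd \<Rightarrow> complex ^ 'r) set" where
  "PolV m v = {conv_pv p v | p. p \<in> Pol m}"

definition fscale :: "complex \<Rightarrow> ('x \<Rightarrow> complex ^ 'r) \<Rightarrow> 'x \<Rightarrow> complex ^ 'r" where
  "fscale c f = (\<lambda>x. c *s f x)"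

interpretation fun_vs: vector_space fscale
  by unfold_locales
    (auto simp: fscale_def fun_eq_iff vec_eq_iff algebra_simps)


section \<open>Subdivision operator and sum rules\<close>

text \<open>For finitely supported \<open>a\<close> only finitely many \<open>k\<close> contribute, for every sequence \<open>u\<close>.\<close>

definition subdiv ::
    "(int ^ 'd::finite \<Rightarrow> complex ^ 'r ^ 'r) \<Rightarrow> (int ^ 'd \<Rightarrow> complex ^ 'r) \<Rightarrow> int ^ 'd \<Rightarrow> complex ^ 'r" where
  "subdiv a u = (\<lambda>j. 2 ^ CARD('d) *s (\<Sum>k | a (j - 2 *s k) \<noteq> 0. u k v* a (j - 2 *s k)))"

definition sum_rules ::
    "nat \<Rightarrow> (int ^ 'd::finite \<Rightarrow> complex ^ 'r ^ 'r) \<Rightarrow> (int ^ 'd \<Rightarrow> complex ^ 'r) \<Rightarrow> bool" where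
  "sum_rules n a y \<longleftrightarrow>
     finite (supp y) \<and> vhat y 0 \<noteq> 0 \<and>
     eq_order n (\<lambda>\<xi>. vhat y (2 *\<^sub>R \<xi>) v* mhat a \<xi>) (vhat y) \<and>
     (\<forall>\<omega>\<in>Gam - {0}. eq_order n (\<lambda>\<xi>. vhat y (2 *\<^sub>R \<xi>) v* mhat a (\<xi> + pi *\<^sub>R emb \<omega>)) (\<lambda>\<xi>. 0))"

end

theory Submission
  imports Defs
begin

text \<open>
  Let \<open>w\<close> be the sequence with Fourier series \<open>vhat v (2 \<xi>) v* mhat a \<xi>\<close>. Splitting the sum defining
  \<open>subdiv a (p * v)\<close> by the characters \<open>chi \<omega>\<close> of the lattice modulo 2 gives
  \<open>subdiv a (p * v) = (\<Sum>\<omega>\<in>Gam. chi \<omega> \<cdot> (P * (chi \<omega> \<cdot> w)))\<close> with \<open>P(x) = p(x/2)\<close>. Polynomials times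
  distinct characters are independent, so this is a polynomial \<open>g\<close> iff the terms with \<open>\<omega> \<noteq> 0\<close> vanish
  and \<open>P * w = g\<close>. Conditions at the origin on Fourier series up to order m are identities of
  convolutions with all polynomials of degree at most m, hence (2), (3) and (4) become the statements
  \<open>subdiv a (p * v) = P * c * v\<close> and \<open>subdiv a (p * b * v) = P * b * v\<close>. The filter c is obtained from (6)
  because every linear functional on polynomials of degree at most m is given by a finitely supported
  sequence, and b is obtained from c degree by degree. In (5), applying a derivative of order m to the
  span shows that the constant \<open>vhat v 0\<close> is fixed.
\<close>

section \<open>Multi-index polynomials\<close>

text \<open>The conditions at the origin involve products of Fourier series, but no product rule
  occurs: each product is first recognised as the series of a single sequence, and the derivatives
  at 0 of one series are moments of that sequence. The assumption \<open>vhat v 0 \<noteq> 0\<close>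
  makes \<open>p \<mapsto> conv_pv p v\<close> injective on polynomials. The polynomial that
  describes the image under subdivision is therefore unique, so it depends linearly on p and
  commutes with translations; these two properties force it to be a convolution with a scalar
  filter. The degree inductions rest on two facts: \<open>p(x - y) - p(x)\<close> loses a degree,
  and so does \<open>p(s x) - s^(m+1) p(x)\<close> when p has degree at most m+1. The correction
  that yields b is solvable because dilation by 1/2 has eigenvalue \<open>(1/2)^(m+1)\<close> on top
  degree but 1 on constants, and these differ. Statements about degree exactly m descend to lower
  degrees by differentiation. The dilation \<open>p(x/2)\<close> makes every derivative cost a
  factor 2, which is the source of all powers of 2.\<close>

lemma finite_vec_box:
  assumes "\<And>i. finite (A i)"
  shows "finite {\<nu> :: 'a ^ 'd::finite. \<forall>i. \<nu> $ i \<in> A i}"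
proof -
  have "{\<nu> :: 'a ^ 'd. \<forall>i. \<nu> $ i \<in> A i} = vec_lambda ` (PiE UNIV A)"
  proof (intro equalityI subsetI)
    fix \<nu> :: "'a ^ 'd" assume "\<nu> \<in> {\<nu>. \<forall>i. \<nu> $ i \<in> A i}"
    then show "\<nu> \<in> vec_lambda ` (PiE UNIV A)"
      by (intro image_eqI[of _ _ "vec_nth \<nu>"]) auto
  qed auto
  moreover have "finite (PiE UNIV A)" using assms by (intro finite_PiE) auto
  ultimately show ?thesis by simp
qed

text \<open>Reduces sums over a box of index vectors to one coordinate at a time; the binomial
  formula, the character sum and interpolation on a grid all rest on it.\<close>

lemma prod_sum_vec:
  fixes f :: "'d::finite \<Rightarrow> 'a \<Rightarrow> 'b::comm_semiring_1"
  assumes "\<And>i. finite (A i)"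
  shows "(\<Prod>i\<in>UNIV. \<Sum>n\<in>A i. f i n) = (\<Sum>\<nu> | \<forall>i. \<nu> $ i \<in> A i. \<Prod>i\<in>UNIV. f i (\<nu> $ i))"
proof -
  have "(\<Prod>i\<in>UNIV. \<Sum>n\<in>A i. f i n) = (\<Sum>g\<in>PiE UNIV A. \<Prod>i\<in>UNIV. f i (g i))"
    using assms by (intro prod_sum_PiE) auto
  also have "\<dots> = (\<Sum>\<nu> | \<forall>i. \<nu> $ i \<in> A i. \<Prod>i\<in>UNIV. f i (\<nu> $ i))"
    by (rule sum.reindex_bij_witness[where i = vec_nth and j = vec_lambda]) auto
  finally show ?thesis .
qed

lemma finite_mdeg_le: "finite {\<mu> :: nat ^ 'd::finite. mdeg \<mu> \<le> m}"
proof (rule finite_subset)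
  show "{\<mu> :: nat ^ 'd. mdeg \<mu> \<le> m} \<subseteq> {\<mu>. \<forall>i. \<mu> $ i \<in> {..m}}"
    unfolding mdeg_def by (auto intro: order_trans[OF member_le_sum[of _ UNIV "($) _"]])
qed (rule finite_vec_box, simp)

lemma atMost_vec_eq: "{\<nu> :: nat ^ 'd::finite. \<nu> \<le> \<mu>} = {\<nu>. \<forall>i. \<nu> $ i \<in> {..\<mu> $ i}}"
  by (simp add: less_eq_vec_def)

lemma finite_atMost_vec: "finite {\<nu> :: nat ^ 'd::finite. \<nu> \<le> \<mu>}"
  unfolding atMost_vec_eq by (rule finite_vec_box) simp

lemma mdeg_diff: "\<nu> \<le> \<mu> \<Longrightarrow> mdeg (\<mu> - \<nu>) = mdeg \<mu> - mdeg (\<nu> :: nat ^ 'd::finite)"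
  unfolding mdeg_def less_eq_vec_def by (simp add: sum_subtractf_nat)

lemma mdeg_mono: "\<nu> \<le> \<mu> \<Longrightarrow> mdeg \<nu> \<le> mdeg (\<mu> :: nat ^ 'd::finite)"
  unfolding mdeg_def less_eq_vec_def by (simp add: sum_mono)

lemma mdeg_add: "mdeg (\<mu> + \<nu>) = mdeg \<mu> + mdeg (\<nu> :: nat ^ 'd::finite)"
  by (simp add: mdeg_def sum.distrib)

lemma mdeg_eq_0: "mdeg \<mu> = 0 \<longleftrightarrow> \<mu> = (0 :: nat ^ 'd::finite)"
  by (simp add: mdeg_def vec_eq_iff)

lemma mfact_pos: "mfact \<mu> > 0"
  by (simp add: mfact_def)

lemma mpow_scaleR: "mpow (s *\<^sub>R x) \<mu> = complex_of_real s ^ mdeg \<mu> * mpow x \<mu>"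
  by (simp add: mpow_def mdeg_def power_mult_distrib prod.distrib power_sum)

text \<open>Divided powers: with the factorial absorbed, the addition formula and the derivatives
  carry no binomial coefficients.\<close>

definition dmono :: "nat ^ 'd::finite \<Rightarrow> real ^ 'd \<Rightarrow> complex" where
  "dmono \<mu> x = mpow x \<mu> / of_nat (mfact \<mu>)"

lemma dmono_eq_prod: "dmono \<mu> x = (\<Prod>i\<in>UNIV. complex_of_real (x $ i) ^ (\<mu> $ i) / fact (\<mu> $ i))"
  by (simp add: dmono_def mpow_def mfact_def prod_dividef)

lemma dmono_0: "dmono 0 x = 1"
  by (simp add: dmono_def mpow_def mfact_def)

lemma mpow_eq_dmono: "mpow x \<mu> = of_nat (mfact \<mu>) * dmono \<mu> x"
  using mfact_pos[of \<mu>] by (simp add: dmono_def)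

lemma dmono_scaleR: "dmono \<mu> (s *\<^sub>R x) = complex_of_real s ^ mdeg \<mu> * dmono \<mu> x"
  by (simp add: dmono_def mpow_scaleR)

lemma binomial_divided:
  fixes a b :: "'a::field_char_0"
  shows "(a + b) ^ n / fact n = (\<Sum>k\<le>n. (a ^ (n - k) / fact (n - k)) * (b ^ k / fact k))"
proof -
  have "(a + b) ^ n / fact n = (\<Sum>k\<le>n. of_nat (n choose k) * b ^ k * a ^ (n - k)) / fact n"
    by (subst add.commute) (simp add: binomial_ring)
  also have "\<dots> = (\<Sum>k\<le>n. (a ^ (n - k) / fact (n - k)) * (b ^ k / fact k))"
    unfolding sum_divide_distrib by (intro sum.cong) (auto simp: binomial_fact field_simps)
  finally show ?thesis .
qed

lemma dmono_add:
  "dmono \<mu> (x + y) = (\<Sum>\<nu> | \<nu> \<le> \<mu>. dmono (\<mu> - \<nu>) x * dmono \<nu> y)"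
  unfolding dmono_eq_prod vector_add_component of_real_add binomial_divided atMost_vec_eq
  by (subst prod_sum_vec) (auto simp flip: prod.distrib)

lemma Pol_dmono_iff:
  "p \<in> Pol m \<longleftrightarrow> (\<exists>c. p = (\<lambda>x. \<Sum>\<mu> | mdeg \<mu> \<le> m. c \<mu> * dmono \<mu> x))"
proof
  assume "p \<in> Pol m"
  then obtain c where "p = (\<lambda>x. \<Sum>\<mu> | mdeg \<mu> \<le> m. c \<mu> * mpow x \<mu>)" by (auto simp: Pol_def)
  then show "\<exists>c. p = (\<lambda>x. \<Sum>\<mu> | mdeg \<mu> \<le> m. c \<mu> * dmono \<mu> x)"
    by (intro exI[of _ "\<lambda>\<mu>. c \<mu> * of_nat (mfact \<mu>)"]) (simp add: mpow_eq_dmono mult.assoc)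
next
  assume "\<exists>c. p = (\<lambda>x. \<Sum>\<mu> | mdeg \<mu> \<le> m. c \<mu> * dmono \<mu> x)"
  then obtain c where "p = (\<lambda>x. \<Sum>\<mu> | mdeg \<mu> \<le> m. c \<mu> * dmono \<mu> x)" by blast
  then show "p \<in> Pol m"
    unfolding Pol_def by (intro CollectI exI[of _ "\<lambda>\<mu>. c \<mu> / of_nat (mfact \<mu>)"]) (simp add: dmono_def)
qed

lemma Pol_add: "p \<in> Pol m \<Longrightarrow> q \<in> Pol m \<Longrightarrow> (\<lambda>x. p x + q x) \<in> Pol m"
  unfolding Pol_def mem_Collect_eq
proof (elim exE)
  fix c d assume "p = (\<lambda>x. \<Sum>\<mu> | mdeg \<mu> \<le> m. c \<mu> * mpow x \<mu>)" "q = (\<lambda>x. \<Sum>\<mu> | mdeg \<mu> \<le> m. d \<mu> * mpow x \<mu>)"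
  then show "\<exists>c. (\<lambda>x. p x + q x) = (\<lambda>x. \<Sum>\<mu> | mdeg \<mu> \<le> m. c \<mu> * mpow x \<mu>)"
    by (intro exI[of _ "\<lambda>\<mu>. c \<mu> + d \<mu>"]) (simp add: sum.distrib ring_distribs)
qed

lemma Pol_scale: "p \<in> Pol m \<Longrightarrow> (\<lambda>x. c * p x) \<in> Pol m"
  unfolding Pol_def mem_Collect_eq
proof (elim exE)
  fix d assume "p = (\<lambda>x. \<Sum>\<mu> | mdeg \<mu> \<le> m. d \<mu> * mpow x \<mu>)"
  then show "\<exists>d. (\<lambda>x. c * p x) = (\<lambda>x. \<Sum>\<mu> | mdeg \<mu> \<le> m. d \<mu> * mpow x \<mu>)"
    by (intro exI[of _ "\<lambda>\<mu>. c * d \<mu>"]) (simp add: sum_distrib_left mult.assoc)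
qed

lemma Pol_zero: "(\<lambda>x. 0) \<in> Pol m"
  unfolding Pol_def by (auto intro: exI[of _ "\<lambda>\<mu>. 0"])

lemma Pol_diff: "p \<in> Pol m \<Longrightarrow> q \<in> Pol m \<Longrightarrow> (\<lambda>x. p x - q x) \<in> Pol m"
  using Pol_add[of p m "\<lambda>x. (-1) * q x"] Pol_scale[of q m "-1"] by simp

lemma Pol_sum: "(\<And>i. i \<in> I \<Longrightarrow> f i \<in> Pol m) \<Longrightarrow> (\<lambda>x. \<Sum>i\<in>I. f i x) \<in> Pol m"
  by (induction I rule: infinite_finite_induct) (simp_all add: Pol_zero Pol_add)

lemma dmono_in_Pol:
  assumes "mdeg \<mu> \<le> m" shows "dmono \<mu> \<in> Pol m"
proof -
  have "dmono \<mu> = (\<lambda>x. \<Sum>\<nu> | mdeg \<nu> \<le> m. (if \<nu> = \<mu> then 1 else 0) * dmono \<nu> x)"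
    using assms by (auto simp: finite_mdeg_le fun_eq_iff if_distrib[of "\<lambda>u. u * _"] cong: if_cong)
  then show ?thesis unfolding Pol_dmono_iff by (intro exI)
qed

lemma Pol_const: "(\<lambda>x. c) \<in> Pol m"
  using Pol_scale[OF dmono_in_Pol[of 0 m], of c] by (simp add: dmono_0 mdeg_def)

lemma Pol_induct [consumes 1, case_names zero step]:
  assumes "p \<in> Pol m" and "P (\<lambda>x. 0)"
    and step: "\<And>c \<mu> p. mdeg \<mu> \<le> m \<Longrightarrow> p \<in> Pol m \<Longrightarrow> P p \<Longrightarrow> P (\<lambda>x. c * dmono \<mu> x + p x)"
  shows "P p"
proof -
  obtain c where p: "p = (\<lambda>x. \<Sum>\<mu> | mdeg \<mu> \<le> m. c \<mu> * dmono \<mu> x)"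
    using assms(1) unfolding Pol_dmono_iff by blast
  have "P (\<lambda>x. \<Sum>\<mu>\<in>A. c \<mu> * dmono \<mu> x)" if "finite A" "A \<subseteq> {\<mu>. mdeg \<mu> \<le> m}" for A
    using that
    by (induction A rule: finite_induct)
      (auto intro!: assms(2) step Pol_sum Pol_scale dmono_in_Pol)
  from this[OF finite_mdeg_le] show ?thesis by (simp add: p)
qed

lemma Pol_mono: "p \<in> Pol m \<Longrightarrow> m \<le> n \<Longrightarrow> p \<in> Pol n"
  by (induction rule: Pol_induct) (auto intro!: Pol_zero Pol_add Pol_scale dmono_in_Pol)

lemma Pol_affine: "p \<in> Pol m \<Longrightarrow> (\<lambda>x. p (s *\<^sub>R x + y)) \<in> Pol m"
proof (induction rule: Pol_induct)
  case (step c \<mu> p)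
  have "(\<lambda>x. dmono \<mu> (s *\<^sub>R x + y)) \<in> Pol m"
    unfolding dmono_add dmono_scaleR
  proof (intro Pol_sum)
    fix \<nu> assume "\<nu> \<in> {\<nu>. \<nu> \<le> \<mu>}"
    then have "(\<lambda>x. (complex_of_real s ^ mdeg (\<mu> - \<nu>) * dmono \<nu> y) * dmono (\<mu> - \<nu>) x) \<in> Pol m"
      using step(1) by (intro Pol_scale dmono_in_Pol) (auto simp: mdeg_diff)
    then show "(\<lambda>x. complex_of_real s ^ mdeg (\<mu> - \<nu>) * dmono (\<mu> - \<nu>) x * dmono \<nu> y) \<in> Pol m"
      by (simp add: mult_ac)
  qed
  with step show ?case by (intro Pol_add Pol_scale) auto
qed (rule Pol_zero)

lemma Pol_shift: "p \<in> Pol m \<Longrightarrow> (\<lambda>x. p (x - y)) \<in> Pol m"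
  using Pol_affine[of p m 1 "-y"] by simp

lemma Pol_dilate: "p \<in> Pol m \<Longrightarrow> (\<lambda>x. p (s *\<^sub>R x)) \<in> Pol m"
  using Pol_affine[of p m s 0] by simp

lemma Pol_0D: "p \<in> Pol 0 \<Longrightarrow> \<exists>c. p = (\<lambda>x. c)"
  by (induction rule: Pol_induct) (auto simp: mdeg_eq_0 dmono_0)

text \<open>In the addition formula the term with \<nu> = 0 is \<open>dmono \<mu> x\<close> itself
  and cancels; every remaining term has lost at least one degree.\<close>

lemma Pol_Suc_shift_diff: "p \<in> Pol (Suc m) \<Longrightarrow> (\<lambda>x. p (x - y) - p x) \<in> Pol m"
proof (induction rule: Pol_induct)
  case (step c \<mu> p)
  have 1: "dmono \<mu> (x - y) - dmono \<mu> x = (\<Sum>\<nu>\<in>{\<nu>. \<nu> \<le> \<mu>} - {0}. dmono \<nu> (-y) * dmono (\<mu> - \<nu>) x)" for x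
  proof -
    have "0 \<in> {\<nu>. \<nu> \<le> \<mu>}" by (simp add: less_eq_vec_def)
    then show ?thesis
      using dmono_add[of \<mu> x "-y"] sum.remove[OF finite_atMost_vec, of 0 \<mu> "\<lambda>\<nu>. dmono (\<mu> - \<nu>) x * dmono \<nu> (-y)"]
      by (simp add: dmono_0 mult.commute)
  qed
  have "(\<lambda>x. dmono \<mu> (x - y) - dmono \<mu> x) \<in> Pol m"
    unfolding 1
  proof (intro Pol_sum Pol_scale dmono_in_Pol)
    fix \<nu> assume "\<nu> \<in> {\<nu>. \<nu> \<le> \<mu>} - {0}"
    then show "mdeg (\<mu> - \<nu>) \<le> m"
      using step(1) mdeg_eq_0[of \<nu>] by (auto simp: mdeg_diff)
  qed
  from Pol_add[OF Pol_scale[OF this, of c] step(3)] show ?case by (simp add: algebra_simps)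
qed (simp add: Pol_zero)

text \<open>Divided monomials are eigenvectors of the dilation with eigenvalue
  \<open>s ^ mdeg \<mu>\<close>; subtracting the eigenvalue of the top degree removes exactly the
  top part.\<close>

lemma Pol_Suc_dilate_diff:
  "p \<in> Pol (Suc m) \<Longrightarrow> (\<lambda>x. p (s *\<^sub>R x) - complex_of_real s ^ Suc m * p x) \<in> Pol m"
proof (induction rule: Pol_induct)
  case (step c \<mu> p)
  have "(\<lambda>x. (complex_of_real s ^ mdeg \<mu> - complex_of_real s ^ Suc m) * dmono \<mu> x) \<in> Pol m"
  proof (cases "mdeg \<mu> = Suc m")
    case False
    with step(1) show ?thesis by (intro Pol_scale dmono_in_Pol) simp
  qed (simp add: Pol_zero)
  from Pol_add[OF Pol_scale[OF this, of c] step(3)] show ?case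
    by (simp add: algebra_simps dmono_scaleR)
qed (simp add: Pol_zero)

text \<open>Leads to univariate \<open>poly\<close>, where a nonzero polynomial has finitely many
  roots.\<close>

lemma Pol_line_poly:
  assumes "p \<in> Pol m"
  shows "\<exists>f :: complex poly. \<forall>t. p (\<chi> j. if j = i then t else x $ j) = poly f (complex_of_real t)"
  using assms
proof (induction rule: Pol_induct)
  case zero
  show ?case by (intro exI[of _ 0]) simp
next
  case (step c \<mu> p)
  from step(3) obtain f where
    f: "\<forall>t. p (\<chi> j. if j = i then t else x $ j) = poly f (complex_of_real t)" ..
  define C where "C = (\<Prod>j\<in>UNIV - {i}. complex_of_real (x $ j) ^ (\<mu> $ j) / fact (\<mu> $ j))"
  have "dmono \<mu> (\<chi> j. if j = i then t else x $ j) = complex_of_real t ^ (\<mu> $ i) / fact (\<mu> $ i) * C" for t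
  proof -
    have "(\<Prod>j\<in>UNIV - {i}. complex_of_real ((\<chi> j. if j = i then t else x $ j) $ j) ^ (\<mu> $ j) / fact (\<mu> $ j)) = C"
      unfolding C_def by (rule prod.cong) simp_all
    then show ?thesis unfolding dmono_eq_prod by (subst prod.remove[of _ i]) simp_all
  qed
  then have "c * dmono \<mu> (\<chi> j. if j = i then t else x $ j) + p (\<chi> j. if j = i then t else x $ j) =
      poly (monom (c * C / fact (\<mu> $ i)) (\<mu> $ i) + f) (complex_of_real t)" for t
    using f by (simp add: poly_monom)
  then show ?case by (intro exI[of _ "monom (c * C / fact (\<mu> $ i)) (\<mu> $ i) + f"] allI)
qed

text \<open>Induction on the set A of coordinates that may be arbitrary reals, the others being
  integers. Freeing one more coordinate leaves a univariate polynomial with infinitely many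
  roots.\<close>

lemma Pol_zero_on_lattice:
  fixes p :: "real ^ 'd::finite \<Rightarrow> complex"
  assumes "p \<in> Pol m" and "\<And>k. p (emb k) = 0"
  shows "p = (\<lambda>x. 0)"
proof -
  have "\<forall>x. (\<forall>j. j \<notin> A \<longrightarrow> x $ j \<in> \<int>) \<longrightarrow> p x = 0" for A :: "'d set"
  proof (induction A rule: infinite_finite_induct)
    case empty
    show ?case
    proof (intro allI impI)
      fix x :: "real ^ 'd" assume "\<forall>j. j \<notin> {} \<longrightarrow> x $ j \<in> \<int>"
      then have "x = emb (\<chi> j. \<lfloor>x $ j\<rfloor>)" by (simp add: emb_def vec_eq_iff)
      then show "p x = 0" using assms(2)[of "\<chi> j. \<lfloor>x $ j\<rfloor>"] by simp
    qed
  next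
    case (insert i A)
    show ?case
    proof (intro allI impI)
      fix x :: "real ^ 'd" assume x: "\<forall>j. j \<notin> insert i A \<longrightarrow> x $ j \<in> \<int>"
      obtain f :: "complex poly" where
        f: "\<forall>t. p (\<chi> j. if j = i then t else x $ j) = poly f (complex_of_real t)"
        using Pol_line_poly[OF assms(1), of i x] ..
      \<comment> \<open>With coordinate i set to a natural number only the coordinates in A are
        free, so the induction hypothesis applies.\<close>
      have "poly f (complex_of_real (real n)) = 0" for n
        unfolding spec[OF f, symmetric] using insert(3) x by simp
      then have "range (\<lambda>n::nat. complex_of_real (real n)) \<subseteq> {z. poly f z = 0}" by auto
      moreover have "infinite (range (\<lambda>n::nat. complex_of_real (real n)))"
        by (intro range_inj_infinite injI) simp
      ultimately have "f = 0" using poly_roots_finite finite_subset by blast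
      then have "p (\<chi> j. if j = i then x $ i else x $ j) = 0" using f by simp
      moreover have "(\<chi> j. if j = i then x $ i else x $ j) = x" by (simp add: vec_eq_iff)
      ultimately show "p x = 0" by simp
    qed
  qed simp
  from this[of UNIV] show ?thesis by auto
qed

section \<open>Partial derivatives of smooth functions\<close>

text \<open>Tailored to iterated \<open>partial\<close>: each iterated partial derivative, in any
  order of the directions, is again differentiable along every axis.\<close>

definition smooth :: "(real ^ 'd::finite \<Rightarrow> 'a::real_normed_vector) \<Rightarrow> bool" where
  "smooth f \<longleftrightarrow> (\<forall>is i x. (\<lambda>t. foldr partial is f (x + t *\<^sub>R axis i 1)) differentiable (at 0))"

lemma smooth_has_partial:
  assumes "smooth f"
  shows "((\<lambda>t. foldr partial is f (x + t *\<^sub>R axis i 1)) has_vector_derivative partial i (foldr partial is f) x) (at 0)"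
  using assms unfolding partial_def smooth_def vector_derivative_works[symmetric] by blast

lemma partial_eqI:
  assumes "\<And>x. ((\<lambda>t. f (x + t *\<^sub>R axis i 1)) has_vector_derivative g x) (at 0)"
  shows "partial i f = g"
  unfolding partial_def using assms by (intro ext vector_derivative_at)

text \<open>A guessed family of closed forms, indexed by the list of directions, only needs one
  differentiation step to be checked. Smoothness comes along because every member of the family is
  differentiable; all closed forms below arise in this way.\<close>

lemma foldr_partial_eq:
  assumes "g [] = f"
    and "\<And>is i x. ((\<lambda>t. g is (x + t *\<^sub>R axis i 1)) has_vector_derivative g (i # is) x) (at 0)"
  shows "foldr partial is f = g is" and "smooth f"
proof -
  have *: "foldr partial is f = g is" for "is"
    by (induction "is") (use assms in \<open>auto intro!: partial_eqI\<close>)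
  then show "foldr partial is f = g is" .
  show "smooth f" unfolding smooth_def * using differentiableI_vector[OF assms(2)] by blast
qed

lemma
  assumes "bounded_linear L" "smooth f"
  shows foldr_partial_linear: "foldr partial is (\<lambda>x. L (f x)) = (\<lambda>x. L (foldr partial is f x))"
    and smooth_linear: "smooth (\<lambda>x. L (f x))"
  using foldr_partial_eq[of "\<lambda>is x. L (foldr partial is f x)" "\<lambda>x. L (f x)"]
    bounded_linear.has_vector_derivative[OF assms(1) smooth_has_partial[OF assms(2)]]
  by auto

lemma
  assumes "smooth f" "smooth g"
  shows foldr_partial_add: "foldr partial is (\<lambda>x. f x + g x) = (\<lambda>x. foldr partial is f x + foldr partial is g x)"
    and smooth_add: "smooth (\<lambda>x. f x + g x)"
  using foldr_partial_eq[of "\<lambda>is x. foldr partial is f x + foldr partial is g x" "\<lambda>x. f x + g x"]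
    has_vector_derivative_add[OF smooth_has_partial[OF assms(1)] smooth_has_partial[OF assms(2)]]
  by auto

lemma
  shows foldr_partial_zero: "foldr partial is (\<lambda>x. 0) = (\<lambda>x. 0)"
    and smooth_zero: "smooth (\<lambda>x. 0)"
  using foldr_partial_eq[of "\<lambda>is x. 0" "\<lambda>x. 0"] by auto

lemma
  assumes "\<And>i. i \<in> I \<Longrightarrow> smooth (f i)"
  shows foldr_partial_sum: "foldr partial is (\<lambda>x. \<Sum>i\<in>I. f i x) = (\<lambda>x. \<Sum>i\<in>I. foldr partial is (f i) x)"
    and smooth_sum: "smooth (\<lambda>x. \<Sum>i\<in>I. f i x)"
proof -
  have "foldr partial is (\<lambda>x. \<Sum>i\<in>I. f i x) = (\<lambda>x. \<Sum>i\<in>I. foldr partial is (f i) x) \<and> smooth (\<lambda>x. \<Sum>i\<in>I. f i x)"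
    using assms
    by (induction I rule: infinite_finite_induct)
      (simp_all add: foldr_partial_zero smooth_zero foldr_partial_add smooth_add)
  then show "foldr partial is (\<lambda>x. \<Sum>i\<in>I. f i x) = (\<lambda>x. \<Sum>i\<in>I. foldr partial is (f i) x)"
    "smooth (\<lambda>x. \<Sum>i\<in>I. f i x)" by auto
qed

lemma
  assumes "smooth f"
  shows foldr_partial_affine:
      "foldr partial is (\<lambda>x. f (s *\<^sub>R x + y)) = (\<lambda>x. s ^ length is *\<^sub>R foldr partial is f (s *\<^sub>R x + y))"
    and smooth_affine: "smooth (\<lambda>x. f (s *\<^sub>R x + y))"
proof -
  have *: "((\<lambda>t. s ^ length is *\<^sub>R foldr partial is f (s *\<^sub>R (x + t *\<^sub>R axis i 1) + y)) has_vector_derivative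
      s ^ length (i # is) *\<^sub>R foldr partial (i # is) f (s *\<^sub>R x + y)) (at 0)" for "is" i x
  proof -
    \<comment> \<open>Chain rule along an axis: moving x by t moves the argument by
      \<open>s * t\<close> along the same axis, which produces one factor s per derivative.\<close>
    have "((\<lambda>t. s * t) has_vector_derivative s) (at 0)"
      by (auto intro!: derivative_eq_intros simp flip: has_real_derivative_iff_has_vector_derivative)
    from vector_diff_chain_at[OF this, of "\<lambda>t. foldr partial is f ((s *\<^sub>R x + y) + t *\<^sub>R axis i 1)"]
      smooth_has_partial[OF assms, of "is" "s *\<^sub>R x + y" i]
    have "((\<lambda>t. foldr partial is f ((s *\<^sub>R x + y) + (s * t) *\<^sub>R axis i 1)) has_vector_derivative
        s *\<^sub>R foldr partial (i # is) f (s *\<^sub>R x + y)) (at 0)"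
      by (simp add: o_def)
    from bounded_linear.has_vector_derivative[OF bounded_linear_scaleR_right this, of "s ^ length is"]
    show ?thesis by (simp add: algebra_simps)
  qed
  show "foldr partial is (\<lambda>x. f (s *\<^sub>R x + y)) = (\<lambda>x. s ^ length is *\<^sub>R foldr partial is f (s *\<^sub>R x + y))"
    "smooth (\<lambda>x. f (s *\<^sub>R x + y))"
    using foldr_partial_eq[of "\<lambda>is x. s ^ length is *\<^sub>R foldr partial is f (s *\<^sub>R x + y)", OF _ *] by auto
qed

section \<open>Iterated partial derivatives of exponentials and of divided monomials\<close>

definition fker :: "int ^ 'd::finite \<Rightarrow> real ^ 'd \<Rightarrow> complex" where
  "fker k \<xi> = exp (- \<i> * complex_of_real (emb k \<bullet> \<xi>))"

text \<open>An exponential is an eigenfunction of every partial derivative, so each direction in the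
  list contributes one scalar factor.\<close>

lemma
  shows foldr_partial_fker:
      "foldr partial is (fker k) = (\<lambda>\<xi>. prod_list (map (\<lambda>i. - \<i> * complex_of_real (emb k $ i)) is) * fker k \<xi>)"
    and smooth_fker: "smooth (fker k)"
proof -
  have *: "((\<lambda>t. c * fker k (\<xi> + t *\<^sub>R axis i 1)) has_vector_derivative
      (- \<i> * complex_of_real (emb k $ i)) * c * fker k \<xi>) (at 0)" for c \<xi> i
  proof -
    have "((\<lambda>z. c * exp (- \<i> * (complex_of_real (emb k \<bullet> \<xi>) + z * complex_of_real (emb k $ i))))
        has_field_derivative (- \<i> * complex_of_real (emb k $ i)) * c * fker k \<xi>) (at (complex_of_real 0))"
      unfolding fker_def by (auto intro!: derivative_eq_intros)
    from has_vector_derivative_real_field[OF this] show ?thesis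
      by (simp add: fker_def inner_add_right inner_axis)
  qed
  show "foldr partial is (fker k) = (\<lambda>\<xi>. prod_list (map (\<lambda>i. - \<i> * complex_of_real (emb k $ i)) is) * fker k \<xi>)"
    "smooth (fker k)"
    using foldr_partial_eq[of "\<lambda>is \<xi>. prod_list (map (\<lambda>i. - \<i> * complex_of_real (emb k $ i)) is) * fker k \<xi>" "fker k"] *
    by auto
qed

text \<open>Only the number of occurrences of each direction matters. The guard is essential because
  subtraction of naturals truncates: once an exponent is exhausted the derivative is 0, not a
  divided monomial.\<close>

lemma
  shows foldr_partial_dmono:
      "foldr partial is (dmono \<mu>) =
        (\<lambda>x. if \<forall>i. count_list is i \<le> \<mu> $ i then dmono (\<chi> i. \<mu> $ i - count_list is i) x else 0)"
    and smooth_dmono: "smooth (dmono \<mu>)"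
proof -
  have 1: "((\<lambda>t. dmono \<mu> (x + t *\<^sub>R axis i 1)) has_vector_derivative
      (if 1 \<le> \<mu> $ i then dmono (\<chi> j. \<mu> $ j - (if j = i then 1 else 0)) x else 0)) (at 0)" for \<mu> i and x :: "real ^ 'a"
  proof -
    \<comment> \<open>The factors of all other coordinates, constant along the axis i.\<close>
    define C where "C = (\<Prod>j\<in>UNIV - {i}. complex_of_real (x $ j) ^ (\<mu> $ j) / fact (\<mu> $ j))"
    have split: "dmono \<nu> y = complex_of_real (y $ i) ^ (\<nu> $ i) / fact (\<nu> $ i) * C"
      if "\<And>j. j \<noteq> i \<Longrightarrow> y $ j = x $ j \<and> \<nu> $ j = \<mu> $ j" for y \<nu>
    proof -
      have "(\<Prod>j\<in>UNIV - {i}. complex_of_real (y $ j) ^ (\<nu> $ j) / fact (\<nu> $ j)) = C"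
        unfolding C_def using that by (intro prod.cong) auto
      then show ?thesis unfolding dmono_eq_prod by (subst prod.remove[of _ i]) auto
    qed
    have t: "dmono \<mu> (x + t *\<^sub>R axis i 1) = (complex_of_real (x $ i) + complex_of_real t) ^ (\<mu> $ i) / fact (\<mu> $ i) * C" for t
      by (subst split) (auto simp: axis_def)
    show ?thesis
    proof (cases "\<mu> $ i")
      case 0
      then show ?thesis by (simp add: t)
    next
      case (Suc n)
      have s: "dmono (\<chi> j. \<mu> $ j - (if j = i then 1 else 0)) x = complex_of_real (x $ i) ^ n / fact n * C"
        by (subst split) (auto simp: Suc)
      have "((\<lambda>z. (complex_of_real (x $ i) + z) ^ Suc n / fact (Suc n) * C) has_field_derivative
          of_nat (Suc n) * complex_of_real (x $ i) ^ n / fact (Suc n) * C) (at (complex_of_real 0))"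
        by (auto intro!: derivative_eq_intros simp del: fact_Suc power_Suc of_nat_Suc)
      also have "of_nat (Suc n) * complex_of_real (x $ i) ^ n / fact (Suc n) * C = complex_of_real (x $ i) ^ n / fact n * C"
        unfolding fact_Suc of_nat_mult by (simp del: of_nat_Suc)
      finally have "((\<lambda>z. (complex_of_real (x $ i) + z) ^ Suc n / fact (Suc n) * C) has_field_derivative
          complex_of_real (x $ i) ^ n / fact n * C) (at (complex_of_real 0))" .
      from has_vector_derivative_real_field[OF this] show ?thesis
        unfolding t s Suc by (simp del: fact_Suc power_Suc)
    qed
  qed
  let ?g = "\<lambda>is x. if \<forall>i. count_list is i \<le> \<mu> $ i then dmono (\<chi> i. \<mu> $ i - count_list is i) x else 0"
  have 2: "((\<lambda>t. ?g is (x + t *\<^sub>R axis i 1)) has_vector_derivative ?g (i # is) x) (at 0)" for "is" i x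
  proof (cases "\<forall>i. count_list is i \<le> \<mu> $ i")
    case True
    have e: "(\<forall>j. count_list (i # is) j \<le> \<mu> $ j) \<longleftrightarrow> 1 \<le> (\<chi> i. \<mu> $ i - count_list is i) $ i"
    proof
      assume "1 \<le> (\<chi> i. \<mu> $ i - count_list is i) $ i"
      with True show "\<forall>j. count_list (i # is) j \<le> \<mu> $ j" by auto
    next
      assume "\<forall>j. count_list (i # is) j \<le> \<mu> $ j"
      from this[rule_format, of i] show "1 \<le> (\<chi> i. \<mu> $ i - count_list is i) $ i" by simp
    qed
    have d: "(\<chi> j. (\<chi> i. \<mu> $ i - count_list is i) $ j - (if j = i then 1 else 0)) = (\<chi> j. \<mu> $ j - count_list (i # is) j)"
      by (auto simp: vec_eq_iff)
    from 1[of "\<chi> i. \<mu> $ i - count_list is i" x i] True show ?thesis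
      unfolding d e[symmetric] by (simp only: simp_thms if_True)
  next
    case False
    then obtain j where "\<mu> $ j < count_list is j" by (auto simp: not_le)
    moreover have "count_list is j \<le> count_list (i # is) j" by simp
    ultimately have "\<not> (\<forall>j. count_list (i # is) j \<le> \<mu> $ j)" by (meson leD le_trans)
    with False show ?thesis by (simp only: if_False) simp
  qed
  have 0: "?g [] = dmono \<mu>" by (auto simp: fun_eq_iff)
  show "foldr partial is (dmono \<mu>) = ?g is" "smooth (dmono \<mu>)"
    using foldr_partial_eq[of ?g, OF 0 2] by auto
qed

text \<open>Flattens the nested iteration in \<open>mderiv\<close> to one fold of
  \<open>partial\<close>, to which the closed forms for lists of directions apply.\<close>

definition mlist :: "nat ^ 'd::finite \<Rightarrow> 'd list" where
  "mlist \<nu> = concat (map (\<lambda>i. replicate (\<nu> $ i) i) (SOME is. distinct is \<and> set is = UNIV))"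

lemma mderiv_eq_foldr:
  fixes f :: "real ^ 'd::finite \<Rightarrow> 'a::real_normed_vector"
  shows "mderiv \<nu> f = foldr partial (mlist \<nu>) f"
proof -
  have 1: "foldr partial (replicate n i) g = (partial i ^^ n) g" for n i and g :: "real ^ 'd \<Rightarrow> 'a"
    by (induction n) auto
  have "foldr (\<lambda>i. partial i ^^ (\<nu> $ i)) is f = foldr partial (concat (map (\<lambda>i. replicate (\<nu> $ i) i) is)) f" for "is"
    by (induction "is") (auto simp: 1)
  then show ?thesis by (simp add: mderiv_def mlist_def)
qed

lemma enum_list: "distinct (SOME is. distinct is \<and> set is = (UNIV :: 'd::finite set))"
  "set (SOME is. distinct is \<and> set is = (UNIV :: 'd::finite set)) = UNIV"
proof -
  have "\<exists>is :: 'd list. distinct is \<and> set is = UNIV" using finite_distinct_list[of "UNIV :: 'd set"] by auto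
  from someI_ex[OF this] show "distinct (SOME is. distinct is \<and> set is = (UNIV :: 'd set))"
    "set (SOME is. distinct is \<and> set is = (UNIV :: 'd set)) = UNIV" by auto
qed

lemma prod_list_mlist:
  fixes f :: "'d::finite \<Rightarrow> 'b::comm_monoid_mult"
  shows "prod_list (map f (mlist \<nu>)) = (\<Prod>i\<in>UNIV. f i ^ (\<nu> $ i))"
proof -
  have "prod_list (map f (concat (map (\<lambda>i. replicate (\<nu> $ i) i) is))) = prod_list (map (\<lambda>i. f i ^ (\<nu> $ i)) is)" for "is"
    by (induction "is") auto
  then show ?thesis
    unfolding mlist_def
    using prod.distinct_set_conv_list[OF enum_list(1), of "\<lambda>i. f i ^ (\<nu> $ i)", unfolded enum_list(2)]
    by simp
qed

lemma count_list_mlist: "count_list (mlist \<nu>) i = \<nu> $ i"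
proof -
  have 1: "count_list (replicate n j) i = (if i = j then n else 0)" for n j by (induction n) auto
  have "distinct is \<Longrightarrow> count_list (concat (map (\<lambda>i. replicate (\<nu> $ i) i) is)) i = (if i \<in> set is then \<nu> $ i else 0)" for "is"
    by (induction "is") (auto simp: 1)
  from this[OF enum_list(1)] show ?thesis unfolding mlist_def enum_list(2) by simp
qed

lemma length_mlist: "length (mlist \<nu>) = mdeg \<nu>"
proof -
  have "length (concat (map (\<lambda>i. replicate (\<nu> $ i) i) is)) = sum_list (map (\<lambda>i. \<nu> $ i) is)" for "is"
    by (induction "is") auto
  then show ?thesis
    unfolding mlist_def mdeg_def
    using sum.distinct_set_conv_list[OF enum_list(1), of "\<lambda>i. \<nu> $ i", unfolded enum_list(2)]
    by simp
qed

lemma mderiv_dmono: "mderiv \<nu> (dmono \<mu>) = (\<lambda>x. if \<nu> \<le> \<mu> then dmono (\<mu> - \<nu>) x else 0)"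
proof -
  have "(\<chi> i. \<mu> $ i - \<nu> $ i) = \<mu> - \<nu>" by (simp add: vec_eq_iff)
  then show ?thesis
    unfolding mderiv_eq_foldr foldr_partial_dmono count_list_mlist less_eq_vec_def by (simp only:)
qed

lemma mderiv_fker: "mderiv \<nu> (fker k) = (\<lambda>\<xi>. (- \<i>) ^ mdeg \<nu> * mpow (emb k) \<nu> * fker k \<xi>)"
  unfolding mderiv_eq_foldr foldr_partial_fker prod_list_mlist power_mult_distrib prod.distrib mpow_def
    mdeg_def power_sum ..

section \<open>Derivatives of polynomials, convolutions and Fourier series\<close>

lemma smooth_Pol: "p \<in> Pol m \<Longrightarrow> smooth p"
proof (induction rule: Pol_induct)
  case (step c \<mu> p)
  from smooth_add[OF smooth_linear[OF bounded_linear_mult_right smooth_dmono] step(3)] show ?case .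
qed (rule smooth_zero)

lemma mderiv_add: "smooth f \<Longrightarrow> smooth g \<Longrightarrow> mderiv \<nu> (\<lambda>x. f x + g x) = (\<lambda>x. mderiv \<nu> f x + mderiv \<nu> g x)"
  by (simp add: mderiv_eq_foldr foldr_partial_add)

lemma mderiv_zero: "mderiv \<nu> (\<lambda>x. 0) = (\<lambda>x. 0)"
  by (simp add: mderiv_eq_foldr foldr_partial_zero)

lemma mderiv_sum:
  "(\<And>i. i \<in> I \<Longrightarrow> smooth (f i)) \<Longrightarrow> mderiv \<nu> (\<lambda>x. \<Sum>i\<in>I. f i x) = (\<lambda>x. \<Sum>i\<in>I. mderiv \<nu> (f i) x)"
  by (simp add: mderiv_eq_foldr foldr_partial_sum)

lemma mderiv_linear:
  "bounded_linear L \<Longrightarrow> smooth f \<Longrightarrow> mderiv \<nu> (\<lambda>x. L (f x)) = (\<lambda>x. L (mderiv \<nu> f x))"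
  by (simp add: mderiv_eq_foldr foldr_partial_linear)

lemma mderiv_affine:
  "smooth f \<Longrightarrow> mderiv \<nu> (\<lambda>x. f (s *\<^sub>R x + y)) = (\<lambda>x. s ^ mdeg \<nu> *\<^sub>R mderiv \<nu> f (s *\<^sub>R x + y))"
  by (simp add: mderiv_eq_foldr foldr_partial_affine length_mlist)

lemma mderiv_Pol_step:
  "p \<in> Pol m \<Longrightarrow> mderiv \<nu> (\<lambda>x. c * dmono \<mu> x + p x) =
    (\<lambda>x. c * (if \<nu> \<le> \<mu> then dmono (\<mu> - \<nu>) x else 0) + mderiv \<nu> p x)"
  by (subst mderiv_add[OF smooth_linear[OF bounded_linear_mult_right smooth_dmono] smooth_Pol])
    (simp_all add: mderiv_linear[OF bounded_linear_mult_right smooth_dmono] mderiv_dmono)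

lemma mderiv_in_Pol: "p \<in> Pol m \<Longrightarrow> mderiv \<nu> p \<in> Pol (m - mdeg \<nu>)"
proof (induction rule: Pol_induct)
  case (step c \<mu> p)
  have "(\<lambda>x. if \<nu> \<le> \<mu> then dmono (\<mu> - \<nu>) x else 0) \<in> Pol (m - mdeg \<nu>)"
    using step(1) by (cases "\<nu> \<le> \<mu>") (auto intro!: Pol_zero dmono_in_Pol simp: mdeg_diff)
  then show ?case unfolding mderiv_Pol_step[OF step(2)] using step(3) by (intro Pol_add Pol_scale)
qed (simp add: mderiv_zero Pol_zero)

lemma mderiv_Pol_eq_0:
  assumes "p \<in> Pol m" "m < mdeg \<nu>" shows "mderiv \<nu> p = (\<lambda>x. 0)"
  using assms
proof (induction rule: Pol_induct)
  case (step c \<mu> p)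
  then have "\<not> \<nu> \<le> \<mu>" using mdeg_mono[of \<nu> \<mu>] by auto
  with step show ?case by (simp add: mderiv_Pol_step)
qed (rule mderiv_zero)

lemma mderiv_scale: "smooth f \<Longrightarrow> mderiv \<nu> (\<lambda>x. (c::complex) * f x) = (\<lambda>x. c * mderiv \<nu> f x)"
  by (rule mderiv_linear[OF bounded_linear_mult_right])

lemma mderiv_dilate: "smooth f \<Longrightarrow> mderiv \<nu> (\<lambda>x. f (s *\<^sub>R x)) = (\<lambda>x. s ^ mdeg \<nu> *\<^sub>R mderiv \<nu> f (s *\<^sub>R x))"
  using mderiv_affine[of f \<nu> s 0] by simp

lemma mderiv_shift: "smooth f \<Longrightarrow> mderiv \<nu> (\<lambda>x. f (x - y)) = (\<lambda>x. mderiv \<nu> f (x - y))"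
  using mderiv_affine[of f \<nu> 1 "-y"] by simp

lemma smooth_shift: "smooth f \<Longrightarrow> smooth (\<lambda>x. f (x - y))"
  using smooth_affine[of f 1 "-y"] by simp

lemma bounded_linear_scale_vec: "bounded_linear (\<lambda>z::complex. z *s (c :: complex ^ 'r::finite))"
  unfolding linear_conv_bounded_linear[symmetric]
  by (rule linearI) (auto simp: vec_eq_iff algebra_simps)

lemma smooth_conv_pv: "smooth p \<Longrightarrow> smooth (conv_pv p v)"
  unfolding conv_pv_def
  by (intro smooth_sum smooth_linear[OF bounded_linear_scale_vec] smooth_shift)

lemma mderiv_conv_pv: "smooth p \<Longrightarrow> mderiv \<nu> (conv_pv p v) = conv_pv (mderiv \<nu> p) v"
  unfolding conv_pv_def
  by (subst mderiv_sum[OF smooth_linear[OF bounded_linear_scale_vec smooth_shift]])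
    (simp_all add: mderiv_linear[OF bounded_linear_scale_vec smooth_shift] mderiv_shift)

lemma sum_supp_superset:
  fixes w :: "'k \<Rightarrow> complex ^ 'r"
  assumes "finite A" "supp w \<subseteq> A"
  shows "(\<Sum>k\<in>supp w. F k *s w k) = (\<Sum>k\<in>A. F k *s w k)"
  using assms by (intro sum.mono_neutral_left) (auto simp: supp_def vec_eq_iff)

lemma fhat_superset: "finite A \<Longrightarrow> supp u \<subseteq> A \<Longrightarrow> fhat u \<xi> = (\<Sum>k\<in>A. fker k \<xi> * u k)"
  unfolding fhat_def fker_def by (subst mult.commute) (intro sum.mono_neutral_left, auto simp: supp_def)

lemma vhat_eq: "finite (supp u) \<Longrightarrow> vhat u \<xi> = (\<Sum>k\<in>supp u. fker k \<xi> *s u k)"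
  by (auto simp: vhat_def vec_eq_iff supp_def intro!: fhat_superset)

lemma vector_matrix_sum_left: "(\<Sum>i\<in>I. x i) v* A = (\<Sum>i\<in>I. x i v* (A :: 'a::comm_semiring_1 ^ 'c ^ 'b::finite))"
  by (induction I rule: infinite_finite_induct)
    (auto simp: vector_matrix_mult_def vec_eq_iff algebra_simps sum.distrib)

lemma mhat_vector_matrix:
  assumes "finite (supp a)"
  shows "x v* mhat a \<xi> = (\<Sum>k\<in>supp a. fker k \<xi> *s (x v* a k))"
proof -
  have "fhat (\<lambda>k. a k $ i $ j) \<xi> = (\<Sum>k\<in>supp a. fker k \<xi> * a k $ i $ j)" for i j
    using assms by (intro fhat_superset) (auto simp: supp_def)
  then show ?thesis
    by (simp add: vec_eq_iff mhat_def vector_matrix_mult_def sum_distrib_left sum_distrib_right mult_ac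
        sum.swap[of _ "supp a"])
qed

lemma mderiv_vhat:
  assumes "finite (supp u)"
  shows "mderiv \<nu> (vhat u) \<xi> = (\<Sum>k\<in>supp u. ((- \<i>) ^ mdeg \<nu> * mpow (emb k) \<nu> * fker k \<xi>) *s u k)"
proof -
  have "vhat u = (\<lambda>\<xi>. \<Sum>k\<in>supp u. fker k \<xi> *s u k)" using vhat_eq[OF assms] by blast
  then show ?thesis
    by (simp add: mderiv_sum smooth_linear[OF bounded_linear_scale_vec smooth_fker]
       mderiv_linear[OF bounded_linear_scale_vec smooth_fker] mderiv_fker)
qed

lemma fker_0: "fker k 0 = 1"
  by (simp add: fker_def)

lemma vhat_0: "finite (supp u) \<Longrightarrow> vhat u 0 = (\<Sum>k\<in>supp u. u k)"
  by (simp add: vhat_eq fker_0)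

lemma conv_pv_const: "finite (supp v) \<Longrightarrow> conv_pv (\<lambda>x. c) v = (\<lambda>x. c *s vhat v 0)"
  by (simp add: conv_pv_def vhat_0 fun_eq_iff vec_eq_iff sum_distrib_left)

lemma conv_pv_add: "conv_pv (\<lambda>x. p x + q x) v = (\<lambda>x. conv_pv p v x + conv_pv q v x)"
  by (simp add: conv_pv_def sum.distrib vec_eq_iff fun_eq_iff ring_distribs)

lemma conv_pv_diff: "conv_pv (\<lambda>x. p x - q x) v = (\<lambda>x. conv_pv p v x - conv_pv q v x)"
  by (simp add: conv_pv_def sum_subtractf vec_eq_iff fun_eq_iff ring_distribs)

lemma conv_pv_scale: "conv_pv (\<lambda>x. c * p x) v = (\<lambda>x. c *s conv_pv p v x)"
  by (simp add: conv_pv_def sum_distrib_left vec_eq_iff fun_eq_iff mult.assoc)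

lemma conv_pv_zero: "conv_pv (\<lambda>x. 0) v = (\<lambda>x. 0)"
  by (simp add: conv_pv_def)

lemma conv_pv_zero_right: "conv_pv p (\<lambda>x. 0) = (\<lambda>x. 0)"
  by (simp add: conv_pv_def)

lemma conv_pv_shift: "conv_pv (\<lambda>x. p (x - y)) v = (\<lambda>x. conv_pv p v (x - y))"
  by (simp add: conv_pv_def algebra_simps)

lemma conv_pv_vPol:
  assumes "p \<in> Pol m"
  shows "conv_pv p v \<in> vPol m"
proof -
  have "(\<lambda>x. \<Sum>k\<in>supp v. v k $ j * p (x - emb k)) \<in> Pol m" for j
    using assms by (intro Pol_sum Pol_scale Pol_shift)
  then show ?thesis by (simp add: vPol_def conv_pv_def mult.commute)
qed

text \<open>
  Taking \<open>p(x) = (-x)\<^sup>\<nu>\<close> and evaluating at 0 turns the polynomial identity into the equality of moments,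
  that is, of derivatives of the Fourier series at the origin.
\<close>

lemma eq_order_vhat_iff:
  fixes u w :: "int ^ 'd::finite \<Rightarrow> complex ^ 'r::finite"
  assumes "finite (supp u)" "finite (supp w)"
  shows "eq_order (Suc m) (vhat u) (vhat w) \<longleftrightarrow> (\<forall>p\<in>Pol m. conv_pv p u = conv_pv p w)"
proof -
  have 1: "(\<Sum>k\<in>supp u. ((- \<i>) ^ mdeg \<nu> * mpow (emb k) \<nu> * fker k 0) *s u k) =
      (- \<i>) ^ mdeg \<nu> *s (\<Sum>k\<in>supp u. mpow (emb k) \<nu> *s u k)" for \<nu> and u :: "int ^ 'd \<Rightarrow> complex ^ 'r"
    by (simp add: vec_eq_iff fker_0 sum_distrib_left mult.assoc)
  have eq: "eq_order (Suc m) (vhat u) (vhat w) \<longleftrightarrow> (\<forall>\<nu>. mdeg \<nu> \<le> m \<longrightarrow>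
      (\<Sum>k\<in>supp u. mpow (emb k) \<nu> *s u k) = (\<Sum>k\<in>supp w. mpow (emb k) \<nu> *s w k))"
    unfolding eq_order_def mderiv_vhat[OF assms(1)] mderiv_vhat[OF assms(2)] 1 less_Suc_eq_le
    by (simp add: vec_eq_iff)
  show ?thesis unfolding eq
  proof (intro iffI ballI allI impI)
    fix p :: "real ^ 'd \<Rightarrow> complex"
    assume mom: "\<forall>\<nu>. mdeg \<nu> \<le> m \<longrightarrow>
      (\<Sum>k\<in>supp u. mpow (emb k) \<nu> *s u k) = (\<Sum>k\<in>supp w. mpow (emb k) \<nu> *s w k)" and p: "p \<in> Pol m"
    \<comment> \<open>For fixed x the map \<open>y \<mapsto> p (x - y)\<close> is a combination of
      monomials of degree at most m, so the convolution at x is a combination of moments.\<close>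
    have "conv_pv p u x = conv_pv p w x" for x
    proof -
      have "(\<lambda>y. p (x - y)) \<in> Pol m" using Pol_affine[OF p, of "-1" x] by simp
      then obtain c where c: "(\<lambda>y. p (x - y)) = (\<lambda>y. \<Sum>\<nu> | mdeg \<nu> \<le> m. c \<nu> * mpow y \<nu>)"
        unfolding Pol_def by blast
      have "conv_pv p u x = (\<Sum>\<nu> | mdeg \<nu> \<le> m. c \<nu> *s (\<Sum>k\<in>supp u. mpow (emb k) \<nu> *s u k))"
        for u :: "int ^ 'd \<Rightarrow> complex ^ 'r"
        unfolding conv_pv_def fun_cong[OF c]
        by (simp add: vec_eq_iff sum_distrib_left sum_distrib_right mult_ac sum.swap[of _ "supp u"])
      then show ?thesis using mom by simp
    qed
    then show "conv_pv p u = conv_pv p w" by blast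
  next
    fix \<nu> :: "nat ^ 'd"
    assume conv: "\<forall>p\<in>Pol m. conv_pv p u = conv_pv p w" and "mdeg \<nu> \<le> m"
    have "(\<lambda>x. of_nat (mfact \<nu>) * dmono \<nu> x) \<in> Pol m"
      using \<open>mdeg \<nu> \<le> m\<close> by (intro Pol_scale dmono_in_Pol)
    then have "(\<lambda>x. mpow x \<nu>) \<in> Pol m" by (simp add: mpow_eq_dmono)
    from Pol_affine[OF this, of "-1" 0] have "(\<lambda>x. mpow (- x) \<nu>) \<in> Pol m" by simp
    with conv have "conv_pv (\<lambda>x. mpow (- x) \<nu>) u 0 = conv_pv (\<lambda>x. mpow (- x) \<nu>) w 0" by simp
    then show "(\<Sum>k\<in>supp u. mpow (emb k) \<nu> *s u k) = (\<Sum>k\<in>supp w. mpow (emb k) \<nu> *s w k)"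
      by (simp add: conv_pv_def)
  qed
qed

section \<open>Convolutions as push-forwards\<close>

text \<open>The image of the weights h under \<phi>, as for image measures. Convolutions and dilated
  convolutions are all of this form, and possible cancellation in the support never has to be
  analysed.\<close>

definition push :: "'x set \<Rightarrow> ('x \<Rightarrow> 'k) \<Rightarrow> ('x \<Rightarrow> complex ^ 'r) \<Rightarrow> 'k \<Rightarrow> complex ^ 'r" where
  "push X \<phi> h n = (\<Sum>x | x \<in> X \<and> \<phi> x = n. h x)"

lemma supp_push_subset: "supp (push X \<phi> h) \<subseteq> \<phi> ` X"
proof (rule subsetI, rule ccontr)
  fix n assume "n \<in> supp (push X \<phi> h)" "n \<notin> \<phi> ` X"
  then have "{x. x \<in> X \<and> \<phi> x = n} = {}" by auto
  then have "push X \<phi> h n = 0" unfolding push_def by (simp only: sum.empty)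
  with \<open>n \<in> supp (push X \<phi> h)\<close> show False by (simp add: supp_def)
qed

lemma finite_supp_push: "finite X \<Longrightarrow> finite (supp (push X \<phi> h))"
  by (rule finite_subset[OF supp_push_subset]) simp

text \<open>Change of variables. As F is arbitrary, exponentials give the Fourier series of a
  push-forward and translated polynomials give its convolutions.\<close>

lemma push_pair:
  assumes "finite X"
  shows "(\<Sum>n\<in>supp (push X \<phi> h). F n *s push X \<phi> h n) = (\<Sum>x\<in>X. F (\<phi> x) *s h x)"
proof -
  have "(\<Sum>n\<in>supp (push X \<phi> h). F n *s push X \<phi> h n) = (\<Sum>n\<in>\<phi> ` X. F n *s push X \<phi> h n)"
    using assms by (intro sum_supp_superset supp_push_subset finite_imageI)
  also have "\<dots> = (\<Sum>n\<in>\<phi> ` X. \<Sum>x | x \<in> X \<and> \<phi> x = n. F (\<phi> x) *s h x)"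
    by (intro sum.cong refl) (simp add: push_def vec_eq_iff sum_distrib_left)
  also have "\<dots> = (\<Sum>x\<in>X. F (\<phi> x) *s h x)"
    using sum.image_gen[OF assms, of "\<lambda>x. F (\<phi> x) *s h x" \<phi>] by simp
  finally show ?thesis .
qed

lemma conv_sv_push:
  assumes "finite (supp b)" "finite (supp v)"
  shows "conv_sv b v = push (supp b \<times> supp v) (\<lambda>(k, l). k + l) (\<lambda>(k, l). b k *s v l)"
proof
  fix n
  have "push (supp b \<times> supp v) (\<lambda>(k, l). k + l) (\<lambda>(k, l). b k *s v l) n
      = (\<Sum>l | l \<in> supp v \<and> n - l \<in> supp b. b (n - l) *s v l)"
    unfolding push_def
    by (rule sum.reindex_bij_witness[of _ "\<lambda>l. (n - l, l)" snd]) auto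
  also have "\<dots> = (\<Sum>l\<in>supp v. b (n - l) *s v l)"
    using assms by (intro sum.mono_neutral_left) (auto simp: supp_def)
  finally show "conv_sv b v n = push (supp b \<times> supp v) (\<lambda>(k, l). k + l) (\<lambda>(k, l). b k *s v l) n"
    by (simp add: conv_sv_def)
qed

lemma finite_supp_conv_sv: "finite (supp b) \<Longrightarrow> finite (supp v) \<Longrightarrow> finite (supp (conv_sv b v))"
  by (simp add: conv_sv_push finite_supp_push)

lemma emb_add: "emb (k + l) = emb k + emb l"
  by (simp add: emb_def vec_eq_iff)

lemma emb_diff: "emb (k - l) = emb k - emb l"
  by (simp add: emb_def vec_eq_iff)

lemma emb_double: "emb (2 *s k) = 2 *\<^sub>R emb k"
  by (simp add: emb_def vec_eq_iff)

lemma emb_0: "emb 0 = 0"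
  by (simp add: emb_def vec_eq_iff)

lemma fker_add: "fker (k + l) \<xi> = fker k \<xi> * fker l \<xi>"
  by (simp add: fker_def emb_add inner_add_left algebra_simps flip: exp_add)

lemma fker_double: "fker (2 *s k) \<xi> = fker k (2 *\<^sub>R \<xi>)"
  by (simp add: fker_def emb_double)

text \<open>A scalar filter viewed as a translation-commuting operator on polynomials.\<close>

definition conv_pp :: "(real ^ 'd::finite \<Rightarrow> complex) \<Rightarrow> (int ^ 'd \<Rightarrow> complex) \<Rightarrow> real ^ 'd \<Rightarrow> complex" where
  "conv_pp p b = (\<lambda>x. \<Sum>k\<in>supp b. p (x - emb k) * b k)"

lemma conv_pv_conv_sv:
  assumes "finite (supp b)" "finite (supp v)"
  shows "conv_pv p (conv_sv b v) = conv_pv (conv_pp p b) v"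
proof
  fix x
  have "conv_pv p (conv_sv b v) x = (\<Sum>(k, l)\<in>supp b \<times> supp v. p (x - emb (k + l)) *s (b k *s v l))"
    unfolding conv_pv_def conv_sv_push[OF assms] using assms
    by (subst push_pair) (auto simp: case_prod_unfold)
  also have "\<dots> = conv_pv (conv_pp p b) v x"
    unfolding conv_pv_def conv_pp_def sum.cartesian_product[symmetric]
    by (subst sum.swap) (simp add: vec_eq_iff sum_distrib_left sum_distrib_right emb_add algebra_simps)
  finally show "conv_pv p (conv_sv b v) x = conv_pv (conv_pp p b) v x" .
qed

lemma vhat_conv_sv:
  assumes "finite (supp b)" "finite (supp v)"
  shows "vhat (conv_sv b v) \<xi> = fhat b \<xi> *s vhat v \<xi>"
proof -
  have "vhat (conv_sv b v) \<xi> = (\<Sum>(k, l)\<in>supp b \<times> supp v. fker (k + l) \<xi> *s (b k *s v l))"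
    unfolding vhat_eq[OF finite_supp_conv_sv[OF assms]] unfolding conv_sv_push[OF assms] using assms
    by (subst push_pair) (auto simp: case_prod_unfold)
  also have "\<dots> = fhat b \<xi> *s vhat v \<xi>"
    unfolding vhat_eq[OF assms(2)] fhat_superset[OF assms(1) subset_refl] sum.cartesian_product[symmetric]
    by (simp add: vec_eq_iff sum_product fker_add algebra_simps)
  finally show ?thesis .
qed

lemma fhat_0: "fhat b 0 = (\<Sum>k\<in>supp b. b k)"
  by (simp add: fhat_def)

section \<open>Characters of the lattice modulo 2\<close>

text \<open>The number \<open>exp (\<i> * pi * (\<omega> \<bullet> n))\<close> as a product of
  signs, hence its own inverse and symmetric in \<omega> and n.\<close>

definition chi :: "int ^ 'd::finite \<Rightarrow> int ^ 'd \<Rightarrow> complex" where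
  "chi \<omega> n = (\<Prod>i\<in>UNIV. if even (\<omega> $ i * n $ i) then 1 else - 1)"

lemma chi_add: "chi \<omega> (n + k) = chi \<omega> n * chi \<omega> k"
  unfolding chi_def prod.distrib[symmetric] by (intro prod.cong) (auto simp: ring_distribs)

lemma chi_diff: "chi \<omega> (n - k) = chi \<omega> n * chi \<omega> k"
  unfolding chi_def prod.distrib[symmetric] by (intro prod.cong) (auto simp: ring_distribs)

lemma chi_double: "chi \<omega> (2 *s k) = 1"
  by (simp add: chi_def)

lemma chi_sym: "chi \<omega> n = chi n \<omega>"
  by (simp add: chi_def mult.commute)

lemma chi_0: "chi 0 n = 1"
  by (simp add: chi_def)

lemma finite_Gam: "finite (Gam :: (int ^ 'd::finite) set)"
  unfolding Gam_def by (rule finite_vec_box) simp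

lemma zero_in_Gam: "0 \<in> Gam"
  by (simp add: Gam_def)

text \<open>Orthogonality: the sum factors over the coordinates, and each factor is 1 + 1 or 1 - 1
  according to the parity of \<open>n $ i\<close>.\<close>

lemma sum_chi: "(\<Sum>\<omega>\<in>Gam. chi \<omega> n) = (if \<forall>i. even (n $ i) then 2 ^ CARD('d) else 0)"
  for n :: "int ^ 'd::finite"
proof -
  have "(\<Sum>\<omega>\<in>Gam. chi \<omega> n) = (\<Prod>i\<in>UNIV. \<Sum>x\<in>{0, 1}. if even (x * n $ i) then 1 else - 1)"
    unfolding chi_def Gam_def by (subst prod_sum_vec) auto
  also have "\<dots> = (\<Prod>i\<in>UNIV. if even (n $ i) then 2 else 0)"
    by (intro prod.cong) auto
  also have "\<dots> = (if \<forall>i. even (n $ i) then 2 ^ CARD('d) else 0)"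
    by auto
  finally show ?thesis .
qed

text \<open>A frequency shift by \<pi>\<omega> is a modulation by a character, since
  \<open>exp (- \<i> * pi * n)\<close> is the sign of the parity of n.\<close>

lemma fker_shift_pi: "fker k (\<xi> + pi *\<^sub>R emb \<omega>) = chi \<omega> k * fker k \<xi>"
proof -
  have "exp (- (\<i> * (pi * of_int n))) = (if even n then 1 else - 1)" for n :: int
  proof -
    have "exp (- (\<i> * (pi * of_int n))) = cis (- (pi * of_int n))" by (simp add: cis_conv_exp)
    also have "\<dots> = (if even n then 1 else - 1)" by (simp add: complex_eq_iff)
    finally show ?thesis .
  qed
  moreover have "- \<i> * complex_of_real (emb k \<bullet> (pi *\<^sub>R emb \<omega>)) = (\<Sum>i\<in>UNIV. - (\<i> * (pi * of_int (\<omega> $ i * k $ i))))"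
    by (simp add: inner_vec_def emb_def sum_distrib_left sum_negf algebra_simps)
  ultimately have "exp (- \<i> * complex_of_real (emb k \<bullet> (pi *\<^sub>R emb \<omega>))) = chi \<omega> k"
    by (simp only: chi_def exp_sum finite_UNIV finite_class.finite_UNIV)
  then show ?thesis
    unfolding fker_def inner_add_right of_real_add distrib_left exp_add by (simp only: mult.commute)
qed

text \<open>Characters are constant on each coset of the even lattice, so on a coset the relation is
  a polynomial identity and extends to all real points. Orthogonality then isolates each
  coefficient.\<close>

lemma chi_poly_independent:
  fixes g :: "int ^ 'd::finite \<Rightarrow> real ^ 'd \<Rightarrow> complex"
  assumes "\<And>\<omega>. \<omega> \<in> Gam \<Longrightarrow> g \<omega> \<in> Pol n"
    and "\<And>j. (\<Sum>\<omega>\<in>Gam. chi \<omega> j * g \<omega> (emb j)) = 0" and "\<omega> \<in> Gam"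
  shows "g \<omega> x = 0"
proof -
  \<comment> \<open>The coset of \<gamma> is parametrised by \<open>2 x + \<gamma>\<close> with x in
    the lattice; afterwards \<open>x = (y - \<gamma>) / 2\<close> reaches any real y.\<close>
  have 1: "(\<Sum>\<omega>\<in>Gam. chi \<omega> \<gamma> * g \<omega> y) = 0" for \<gamma> y
  proof -
    have "(\<lambda>x. \<Sum>\<omega>\<in>Gam. chi \<omega> \<gamma> * g \<omega> (2 *\<^sub>R x + emb \<gamma>)) \<in> Pol n"
      using assms(1) by (intro Pol_sum Pol_scale Pol_affine)
    moreover have "(\<Sum>\<omega>\<in>Gam. chi \<omega> \<gamma> * g \<omega> (2 *\<^sub>R emb k + emb \<gamma>)) = 0" for k
      using assms(2)[of "2 *s k + \<gamma>"] by (simp add: chi_add chi_double emb_add emb_double)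
    ultimately have "(\<lambda>x. \<Sum>\<omega>\<in>Gam. chi \<omega> \<gamma> * g \<omega> (2 *\<^sub>R x + emb \<gamma>)) = (\<lambda>x. 0)"
      by (rule Pol_zero_on_lattice)
    from fun_cong[OF this, of "(1/2) *\<^sub>R (y - emb \<gamma>)"] show ?thesis by simp
  qed
  \<comment> \<open>Entries of \<open>Gam\<close> are 0 or 1, so two of its elements with even sum
    coincide.\<close>
  have 2: "(\<Sum>\<gamma>\<in>Gam. chi \<omega> \<gamma> * chi \<omega>' \<gamma>) = (if \<omega>' = \<omega> then 2 ^ CARD('d) else 0)" if "\<omega>' \<in> Gam" for \<omega>'
  proof -
    have "(\<forall>i. even ((\<omega> + \<omega>') $ i)) \<longleftrightarrow> \<omega>' = \<omega>"
    proof
      assume e: "\<forall>i. even ((\<omega> + \<omega>') $ i)"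
      have "\<omega>' $ i = \<omega> $ i" for i
      proof -
        have "\<omega> $ i \<in> {0, 1}" "\<omega>' $ i \<in> {0, 1}"
          using assms(3) that unfolding Gam_def mem_Collect_eq by blast+
        with e[rule_format, of i] show ?thesis by auto
      qed
      then show "\<omega>' = \<omega>" by (simp add: vec_eq_iff)
    qed auto
    then show ?thesis
      using sum_chi[of "\<omega> + \<omega>'"] by (simp add: chi_add chi_sym[of _ "\<omega> + \<omega>'"] chi_sym[of \<omega>] chi_sym[of \<omega>'])
  qed
  have "0 = (\<Sum>\<gamma>\<in>Gam. chi \<omega> \<gamma> * (\<Sum>\<omega>'\<in>Gam. chi \<omega>' \<gamma> * g \<omega>' x))" by (simp add: 1)
  also have "\<dots> = (\<Sum>\<omega>'\<in>Gam. (\<Sum>\<gamma>\<in>Gam. chi \<omega> \<gamma> * chi \<omega>' \<gamma>) * g \<omega>' x)"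
    unfolding sum_distrib_left sum_distrib_right mult.assoc by (rule sum.swap)
  also have "\<dots> = (\<Sum>\<omega>'\<in>Gam. (if \<omega>' = \<omega> then 2 ^ CARD('d) else 0) * g \<omega>' x)"
    by (intro sum.cong) (auto simp: 2)
  also have "\<dots> = 2 ^ CARD('d) * g \<omega> x"
    using assms(3) by (simp add: finite_Gam if_distrib[of "\<lambda>u. u * _"] cong: if_cong)
  finally show ?thesis by simp
qed

section \<open>The subdivision operator on polynomials\<close>

text \<open>\<open>ring_seq a v\<close> has the Fourier series \<open>vhat v (2 \<xi>) v* mhat a \<xi>\<close>, the paper's v with a ring.\<close>

definition ring_seq ::
    "(int ^ 'd::finite \<Rightarrow> complex ^ 'r ^ 'r) \<Rightarrow> (int ^ 'd \<Rightarrow> complex ^ 'r) \<Rightarrow> int ^ 'd \<Rightarrow> complex ^ 'r" where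
  "ring_seq a v = push (supp v \<times> supp a) (\<lambda>(l, k). k + 2 *s l) (\<lambda>(l, k). v l v* a k)"

text \<open>On the Fourier side this is the shift of the frequency by \<pi>\<omega>.\<close>

definition twist :: "int ^ 'd::finite \<Rightarrow> (int ^ 'd \<Rightarrow> complex ^ 'r) \<Rightarrow> int ^ 'd \<Rightarrow> complex ^ 'r" where
  "twist \<omega> w n = chi \<omega> n *s w n"

lemma chi_nonzero: "chi \<omega> n \<noteq> 0"
  by (simp add: chi_def)

lemma supp_twist: "supp (twist \<omega> w) = supp w"
  by (auto simp: supp_def twist_def chi_nonzero vec_eq_iff)

lemma twist_0: "twist 0 w = w"
  by (simp add: twist_def chi_0 fun_eq_iff)

lemma finite_supp_ring_seq:
  "finite (supp a) \<Longrightarrow> finite (supp v) \<Longrightarrow> finite (supp (ring_seq a v))"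
  by (simp add: ring_seq_def finite_supp_push)

text \<open>In the index \<open>k + 2 *s l\<close> the part \<open>2 *s l\<close> doubles the
  frequency for v and is invisible to the character, which therefore falls on the mask
  alone.\<close>

lemma vhat_twist_ring_seq:
  fixes a :: "int ^ 'd::finite \<Rightarrow> complex ^ 'r::finite ^ 'r"
  assumes "finite (supp a)" "finite (supp v)"
  shows "vhat v (2 *\<^sub>R \<xi>) v* mhat a (\<xi> + pi *\<^sub>R emb \<omega>) = vhat (twist \<omega> (ring_seq a v)) \<xi>"
proof -
  have "vhat (twist \<omega> (ring_seq a v)) \<xi> = (\<Sum>n\<in>supp (ring_seq a v). (chi \<omega> n * fker n \<xi>) *s ring_seq a v n)"
    using finite_supp_ring_seq[OF assms]
    by (subst vhat_eq) (auto simp: supp_twist twist_def vec_eq_iff algebra_simps)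
  also have "\<dots> = (\<Sum>(l, k)\<in>supp v \<times> supp a. (chi \<omega> (k + 2 *s l) * fker (k + 2 *s l) \<xi>) *s (v l v* a k))"
    unfolding ring_seq_def using assms by (subst push_pair) (auto simp: case_prod_unfold)
  also have "\<dots> = vhat v (2 *\<^sub>R \<xi>) v* mhat a (\<xi> + pi *\<^sub>R emb \<omega>)"
    unfolding mhat_vector_matrix[OF assms(1)] vhat_eq[OF assms(2)] vector_matrix_sum_left
      sum.cartesian_product[symmetric]
    by (subst sum.swap) (simp add: scalar_vector_matrix_assoc vec_eq_iff sum_distrib_left chi_add chi_double fker_add
        fker_double fker_shift_pi algebra_simps)
  finally show ?thesis by simp
qed

text \<open>Both sides sum over the same pairs, because
  \<open>(x - k) / 2 - l = (x - (k + 2 l)) / 2\<close>.\<close>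

lemma conv_pm_conv_pv:
  fixes a :: "int ^ 'd::finite \<Rightarrow> complex ^ 'r::finite ^ 'r"
  assumes "finite (supp a)" "finite (supp v)"
  shows "conv_pm (\<lambda>x. conv_pv p v ((1/2) *\<^sub>R x)) a = conv_pv (\<lambda>x. p ((1/2) *\<^sub>R x)) (ring_seq a v)"
proof
  fix x
  have "conv_pv (\<lambda>x. p ((1/2) *\<^sub>R x)) (ring_seq a v) x =
      (\<Sum>(l, k)\<in>supp v \<times> supp a. p ((1/2) *\<^sub>R (x - emb (k + 2 *s l))) *s (v l v* a k))"
    unfolding conv_pv_def ring_seq_def using assms by (subst push_pair) (auto simp: case_prod_unfold)
  also have "\<dots> = conv_pm (\<lambda>x. conv_pv p v ((1/2) *\<^sub>R x)) a x"
    unfolding conv_pm_def conv_pv_def vector_matrix_sum_left sum.cartesian_product[symmetric]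
    by (subst sum.swap) (simp add: scalar_vector_matrix_assoc emb_add emb_double algebra_simps)
  finally show "conv_pm (\<lambda>x. conv_pv p v ((1/2) *\<^sub>R x)) a x = conv_pv (\<lambda>x. p ((1/2) *\<^sub>R x)) (ring_seq a v) x" by simp
qed

text \<open>Subdivision at j sees only the mask entries k congruent to j modulo 2. The indicator of
  this congruence, multiplied by the normalizing power of 2, is the sum of
  \<open>chi \<omega> (j - k)\<close> over \<open>Gam\<close>.\<close>

lemma subdiv_conv_pv:
  fixes a :: "int ^ 'd::finite \<Rightarrow> complex ^ 'r::finite ^ 'r"
  assumes "finite (supp a)" "finite (supp v)"
  shows "subdiv a (restr (conv_pv p v)) j =
    (\<Sum>\<omega>\<in>Gam. chi \<omega> j *s conv_pv (\<lambda>x. p ((1/2) *\<^sub>R x)) (twist \<omega> (ring_seq a v)) (emb j))"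
proof -
  let ?f = "\<lambda>l k. p ((1/2) *\<^sub>R (emb j - emb (k + 2 *s l))) *s (v l v* a k)"
  have "conv_pv (\<lambda>x. p ((1/2) *\<^sub>R x)) (twist \<omega> (ring_seq a v)) (emb j) =
      (\<Sum>(l, k)\<in>supp v \<times> supp a. chi \<omega> k *s ?f l k)" for \<omega>
  proof -
    have "conv_pv (\<lambda>x. p ((1/2) *\<^sub>R x)) (twist \<omega> (ring_seq a v)) (emb j) =
        (\<Sum>n\<in>supp (ring_seq a v). (chi \<omega> n * p ((1/2) *\<^sub>R (emb j - emb n))) *s ring_seq a v n)"
      by (simp add: conv_pv_def supp_twist twist_def mult_ac)
    also have "\<dots> = (\<Sum>(l, k)\<in>supp v \<times> supp a. chi \<omega> k *s ?f l k)"
      unfolding ring_seq_def using assms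
      by (subst push_pair) (auto simp: case_prod_unfold chi_add chi_double)
    finally show ?thesis .
  qed
  then have "(\<Sum>\<omega>\<in>Gam. chi \<omega> j *s conv_pv (\<lambda>x. p ((1/2) *\<^sub>R x)) (twist \<omega> (ring_seq a v)) (emb j)) =
      (\<Sum>\<omega>\<in>Gam. \<Sum>(l, k)\<in>supp v \<times> supp a. chi \<omega> (j - k) *s ?f l k)"
    by (simp add: chi_diff vec_eq_iff sum_distrib_left case_prod_unfold mult.assoc)
  also have "\<dots> = (\<Sum>(l, k)\<in>supp v \<times> supp a. (\<Sum>\<omega>\<in>Gam. chi \<omega> (j - k)) *s ?f l k)"
    by (subst sum.swap) (simp add: vec_eq_iff sum_distrib_right case_prod_unfold)
  also have "\<dots> = (\<Sum>k\<in>supp a. (if \<forall>i. even ((j - k) $ i) then 2 ^ CARD('d) else 0) *s (\<Sum>l\<in>supp v. ?f l k))"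
    unfolding sum_chi sum.cartesian_product[symmetric]
    by (subst sum.swap) (simp add: vec_eq_iff sum_distrib_left mult.assoc)
  also have "\<dots> = (\<Sum>k | k \<in> supp a \<and> (\<forall>i. even ((j - k) $ i)). 2 ^ CARD('d) *s (\<Sum>l\<in>supp v. ?f l k))"
    using assms(1) by (intro sum.mono_neutral_cong_right) auto
  \<comment> \<open>From mask indices k to sequence indices \<open>(j - k) / 2\<close>, an integer
    vector by the parity condition.\<close>
  also have "\<dots> = (\<Sum>k | a (j - 2 *s k) \<noteq> 0. 2 ^ CARD('d) *s (restr (conv_pv p v) k v* a (j - 2 *s k)))"
  proof (rule sum.reindex_bij_witness[of _ "\<lambda>k. j - 2 *s k" "\<lambda>k. \<chi> i. (j - k) $ i div 2"])
    fix k assume k: "k \<in> {k. k \<in> supp a \<and> (\<forall>i. even ((j - k) $ i))}"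
    then show *: "j - 2 *s (\<chi> i. (j - k) $ i div 2) = k" by (simp add: vec_eq_iff)
    then show "(\<chi> i. (j - k) $ i div 2) \<in> {k. a (j - 2 *s k) \<noteq> 0}" using k by (simp add: supp_def)
    define k' where "k' = (\<chi> i. (j - k) $ i div 2)"
    have k': "k = j - 2 *s k'" using * by (simp add: k'_def)
    show "2 ^ CARD('d) *s (restr (conv_pv p v) (\<chi> i. (j - k) $ i div 2) v* a (j - 2 *s (\<chi> i. (j - k) $ i div 2))) =
        2 ^ CARD('d) *s (\<Sum>l\<in>supp v. ?f l k)"
      unfolding k'_def[symmetric] k' restr_def conv_pv_def vector_matrix_sum_left
      by (simp add: scalar_vector_matrix_assoc emb_add emb_diff emb_double algebra_simps)
  next
    fix k assume "k \<in> {k. a (j - 2 *s k) \<noteq> 0}"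
    then show "(\<chi> i. (j - (j - 2 *s k)) $ i div 2) = k"
      and "j - 2 *s k \<in> {k. k \<in> supp a \<and> (\<forall>i. even ((j - k) $ i))}"
      by (auto simp: vec_eq_iff supp_def)
  qed
  also have "\<dots> = subdiv a (restr (conv_pv p v)) j"
    by (simp add: subdiv_def vec_eq_iff sum_distrib_left)
  finally show ?thesis by simp
qed

text \<open>The degree bound n of g is independent of m, so a polynomial of unknown degree may be
  tested; the equation itself then identifies it.\<close>

lemma subdiv_eq_poly_iff:
  fixes a :: "int ^ 'd::finite \<Rightarrow> complex ^ 'r::finite ^ 'r"
  assumes "finite (supp a)" "finite (supp v)" "p \<in> Pol m" "g \<in> vPol n"
  shows "subdiv a (restr (conv_pv p v)) = restr g \<longleftrightarrow>
    (\<forall>\<omega>\<in>Gam - {0}. conv_pv (\<lambda>x. p ((1/2) *\<^sub>R x)) (twist \<omega> (ring_seq a v)) = (\<lambda>x. 0)) \<and>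
    conv_pv (\<lambda>x. p ((1/2) *\<^sub>R x)) (ring_seq a v) = g"
proof -
  define f where "f \<omega> = conv_pv (\<lambda>x. p ((1/2) *\<^sub>R x)) (twist \<omega> (ring_seq a v))" for \<omega>

  have split: "(\<Sum>\<omega>\<in>Gam. F \<omega>) = F 0 + (\<Sum>\<omega>\<in>Gam - {0}. F \<omega>)" for F :: "int ^ 'd \<Rightarrow> complex ^ 'r"
    by (rule sum.remove[OF finite_Gam zero_in_Gam])
  have "subdiv a (restr (conv_pv p v)) = restr g \<longleftrightarrow> (\<forall>\<omega>\<in>Gam - {0}. f \<omega> = (\<lambda>x. 0)) \<and> f 0 = g"
  proof
    assume "(\<forall>\<omega>\<in>Gam - {0}. f \<omega> = (\<lambda>x. 0)) \<and> f 0 = g"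
    then show "subdiv a (restr (conv_pv p v)) = restr g"
      unfolding fun_eq_iff[of "subdiv _ _"] subdiv_conv_pv[OF assms(1,2)] f_def[symmetric] split
      by (simp add: restr_def chi_0 vec_eq_iff)
  next
    assume eq: "subdiv a (restr (conv_pv p v)) = restr g"
    \<comment> \<open>Moving g into the coefficient of the trivial character turns the equation into
      a vanishing combination of characters.\<close>
    define h where "h \<omega> x = f \<omega> x - (if \<omega> = 0 then g x else 0)" for \<omega> x
    have "(\<Sum>\<omega>\<in>Gam. chi \<omega> j *s h \<omega> (emb j)) = 0" for j
    proof -
      have "(\<Sum>\<omega>\<in>Gam. chi \<omega> j *s h \<omega> (emb j)) = (\<Sum>\<omega>\<in>Gam. chi \<omega> j *s f \<omega> (emb j)) - g (emb j)"
      proof -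
        have "(\<Sum>\<omega>\<in>Gam - {0}. chi \<omega> j *s h \<omega> (emb j)) = (\<Sum>\<omega>\<in>Gam - {0}. chi \<omega> j *s f \<omega> (emb j))"
          by (intro sum.cong) (auto simp: h_def)
        then show ?thesis unfolding split by (simp add: h_def chi_0 vec_eq_iff)
      qed
      then show ?thesis
        using fun_cong[OF eq, of j] unfolding subdiv_conv_pv[OF assms(1,2)] f_def[symmetric]
        by (simp add: restr_def)
    qed
    then have sum: "(\<Sum>\<omega>\<in>Gam. chi \<omega> j * h \<omega> (emb j) $ i) = 0" for i j
      unfolding vec_eq_iff by simp
    have pol: "(\<lambda>x. h \<omega> x $ i) \<in> Pol (m + n)" for \<omega> i
    proof -
      have "(\<lambda>x. f \<omega> x $ i) \<in> Pol m"
        using conv_pv_vPol[OF Pol_dilate[OF assms(3)]] unfolding f_def vPol_def by blast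
      moreover have "(\<lambda>x. if \<omega> = 0 then g x $ i else 0) \<in> Pol n"
        using assms(4) by (cases "\<omega> = 0") (auto simp: vPol_def Pol_zero)
      ultimately have "(\<lambda>x. f \<omega> x $ i - (if \<omega> = 0 then g x $ i else 0)) \<in> Pol (m + n)"
        by (intro Pol_diff) (auto elim: Pol_mono)
      moreover have "(\<lambda>x. h \<omega> x $ i) = (\<lambda>x. f \<omega> x $ i - (if \<omega> = 0 then g x $ i else 0))"
        by (auto simp: h_def)
      ultimately show ?thesis by simp
    qed
    have h: "h \<omega> x = 0" if "\<omega> \<in> Gam" for \<omega> x
      using chi_poly_independent[of "\<lambda>\<omega> x. h \<omega> x $ _", OF pol sum that] by (simp add: vec_eq_iff)
    have "f \<omega> = (\<lambda>x. 0)" if "\<omega> \<in> Gam - {0}" for \<omega>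
      using h[of \<omega>] that by (simp add: h_def fun_eq_iff)
    moreover have "f 0 = g"
      using h[OF zero_in_Gam] by (simp add: h_def fun_eq_iff)
    ultimately show "(\<forall>\<omega>\<in>Gam - {0}. f \<omega> = (\<lambda>x. 0)) \<and> f 0 = g" by blast
  qed
  then show ?thesis unfolding f_def twist_0 .
qed

text \<open>A sequence cannot be differentiated, but the equation is equivalent to identities
  between polynomials, and these can. The argument x/2 of p accounts for the power of 2.\<close>

lemma subdiv_mderiv:
  fixes a :: "int ^ 'd::finite \<Rightarrow> complex ^ 'r::finite ^ 'r"
  assumes fin: "finite (supp a)" "finite (supp v)" and p: "p \<in> Pol m" and g: "g \<in> vPol n"
    and eq: "subdiv a (restr (conv_pv p v)) = restr g"
  shows "subdiv a (restr (conv_pv (mderiv \<nu> p) v)) = restr (\<lambda>x. 2 ^ mdeg \<nu> *s mderiv \<nu> g x)"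
proof -
  let ?P = "\<lambda>x. p ((1/2) *\<^sub>R x)"
  let ?P' = "\<lambda>x. mderiv \<nu> p ((1/2) *\<^sub>R x)"
  have P': "?P' = (\<lambda>x. 2 ^ mdeg \<nu> * mderiv \<nu> ?P x)"
    unfolding mderiv_dilate[OF smooth_Pol[OF p]]
    by (simp add: fun_eq_iff scaleR_conv_of_real power_one_over)
  have conv: "conv_pv ?P' u = (\<lambda>x. 2 ^ mdeg \<nu> *s mderiv \<nu> (conv_pv ?P u) x)" for u :: "int ^ 'd \<Rightarrow> complex ^ 'r"
    unfolding P' conv_pv_scale mderiv_conv_pv[OF smooth_Pol[OF Pol_dilate[OF p]]] ..
  have p': "mderiv \<nu> p \<in> Pol m" using Pol_mono[OF mderiv_in_Pol[OF p]] by simp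
  note * = eq[unfolded subdiv_eq_poly_iff[OF fin p g]]
  have g': "(\<lambda>x. 2 ^ mdeg \<nu> *s mderiv \<nu> g x) = conv_pv ?P' (ring_seq a v)"
    using * conv[of "ring_seq a v"] by simp
  have "conv_pv ?P' (twist \<omega> (ring_seq a v)) = (\<lambda>x. 0)" if "\<omega> \<in> Gam - {0}" for \<omega>
    unfolding conv using * that by (simp add: mderiv_zero)
  then show ?thesis
    unfolding g' subdiv_eq_poly_iff[OF fin p' conv_pv_vPol[OF Pol_dilate[OF p']]] by blast
qed

text \<open>The kernel is translation invariant, so it contains the differences of p, which have
  lower degree and vanish by induction. Thus p is a constant c, and \<open>c *s vhat v 0 = 0\<close>
  forces c = 0.\<close>

lemma conv_pv_eq_0:
  assumes "finite (supp v)" "vhat v 0 \<noteq> 0" "p \<in> Pol m" "conv_pv p v = (\<lambda>x. 0)"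
  shows "p = (\<lambda>x. 0)"
  using assms(3,4)
proof (induction m arbitrary: p)
  case 0
  obtain c where c: "p = (\<lambda>x. c)" using Pol_0D[OF 0(1)] by blast
  have "conv_pv (\<lambda>x. c) v 0 = 0" using 0(2) c by simp
  then have "c = 0" using assms(2) by (auto simp: conv_pv_const[OF assms(1)] vec_eq_iff)
  then show ?case using c by simp
next
  case (Suc m)
  have "p x = p 0" for x
  proof -
    \<comment> \<open>With this shift, the difference evaluated at 0 is
      \<open>p x - p 0\<close>.\<close>
    have "conv_pv (\<lambda>z. p (z - (- x)) - p z) v = (\<lambda>z. 0)"
      unfolding conv_pv_diff conv_pv_shift Suc.prems(2) by simp
    from Suc.IH[OF Pol_Suc_shift_diff[OF Suc.prems(1)] this] show ?thesis
      by (metis add_0 diff_minus_eq_add eq_iff_diff_eq_0)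
  qed
  then obtain c where c: "p = (\<lambda>x. c)" by blast
  have "conv_pv (\<lambda>x. c) v 0 = 0" using Suc.prems(2) c by simp
  then have "c = 0" using assms(2) by (auto simp: conv_pv_const[OF assms(1)] vec_eq_iff)
  then show ?case using c by simp
qed

lemma conv_pv_inj:
  assumes "finite (supp v)" "vhat v 0 \<noteq> 0" "p \<in> Pol m" "q \<in> Pol m" "conv_pv p v = conv_pv q v"
  shows "p = q"
proof -
  have "conv_pv (\<lambda>x. p x - q x) v = (\<lambda>x. 0)" unfolding conv_pv_diff assms(5) by simp
  from conv_pv_eq_0[OF assms(1,2) Pol_diff[OF assms(3,4)] this] show ?thesis by (simp add: fun_eq_iff)
qed

section \<open>Scalar filters acting on polynomials\<close>

lemma conv_pp_superset:
  "finite A \<Longrightarrow> supp b \<subseteq> A \<Longrightarrow> conv_pp p b x = (\<Sum>k\<in>A. p (x - emb k) * b k)"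
  unfolding conv_pp_def by (intro sum.mono_neutral_left) (auto simp: supp_def)

lemma conv_pp_in_Pol:
  assumes "p \<in> Pol m" shows "conv_pp p b \<in> Pol m"
proof -
  have "(\<lambda>x. \<Sum>k\<in>supp b. b k * p (x - emb k)) \<in> Pol m"
    using assms by (intro Pol_sum Pol_scale Pol_shift)
  then show ?thesis by (simp add: conv_pp_def mult.commute)
qed

lemma conv_pp_add: "conv_pp (\<lambda>x. p x + q x) b = (\<lambda>x. conv_pp p b x + conv_pp q b x)"
  by (simp add: conv_pp_def sum.distrib fun_eq_iff ring_distribs)

lemma conv_pp_diff: "conv_pp (\<lambda>x. p x - q x) b = (\<lambda>x. conv_pp p b x - conv_pp q b x)"
  by (simp add: conv_pp_def sum_subtractf fun_eq_iff ring_distribs)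

lemma conv_pp_scale: "conv_pp (\<lambda>x. c * p x) b = (\<lambda>x. c * conv_pp p b x)"
  by (simp add: conv_pp_def sum_distrib_left fun_eq_iff mult.assoc)

lemma conv_pp_shift: "conv_pp (\<lambda>x. p (x - y)) b = (\<lambda>x. conv_pp p b (x - y))"
  by (simp add: conv_pp_def algebra_simps)

lemma conv_pp_const: "conv_pp (\<lambda>x. c) b = (\<lambda>x. c * fhat b 0)"
  by (simp add: conv_pp_def fhat_0 sum_distrib_left)

lemma conv_pp_add_right:
  assumes "finite (supp b)" "finite (supp u)"
  shows "conv_pp p (\<lambda>k. b k + u k) x = conv_pp p b x + conv_pp p u x"
proof -
  let ?A = "supp b \<union> supp u"
  have "supp (\<lambda>k. b k + u k) \<subseteq> ?A" by (auto simp: supp_def)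
  then show ?thesis
    using assms
    by (simp add: conv_pp_superset[of ?A b] conv_pp_superset[of ?A u] conv_pp_superset[of ?A "\<lambda>k. b k + u k"]
        ring_distribs sum.distrib)
qed

text \<open>As the entries of b sum to 1, the defect is a combination of differences of p, each of
  lower degree.\<close>

lemma conv_pp_minus_in_Pol:
  assumes "fhat b 0 = 1" "p \<in> Pol (Suc m)"
  shows "(\<lambda>x. p x - conv_pp p b x) \<in> Pol m"
proof -
  have "(\<lambda>x. \<Sum>k\<in>supp b. (- b k) * (p (x - emb k) - p x)) \<in> Pol m"
    using assms(2) by (intro Pol_sum Pol_scale Pol_Suc_shift_diff)
  moreover have "(\<Sum>k\<in>supp b. (- b k) * (p (x - emb k) - p x)) = p x - conv_pp p b x" for x
  proof -
    have "(\<Sum>k\<in>supp b. (- b k) * (p (x - emb k) - p x)) = (\<Sum>k\<in>supp b. b k) * p x - conv_pp p b x"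
      unfolding conv_pp_def sum_distrib_right sum_subtractf[symmetric] by (intro sum.cong) (auto simp: algebra_simps)
    then show ?thesis using assms(1) by (simp add: fhat_0)
  qed
  ultimately show ?thesis by simp
qed

text \<open>Taking q as its own approximate preimage leaves an error of lower degree, which has a
  preimage by induction.\<close>

lemma conv_pp_surj:
  assumes "fhat b 0 = 1" "q \<in> Pol m"
  shows "\<exists>p\<in>Pol m. conv_pp p b = q"
  using assms(2)
proof (induction m arbitrary: q)
  case 0
  obtain c where "q = (\<lambda>x. c)" using Pol_0D[OF 0] by blast
  then show ?case using assms(1) by (intro bexI[of _ q]) (simp_all add: conv_pp_const Pol_const)
next
  case (Suc m)
  obtain p where p: "p \<in> Pol m" "conv_pp p b = (\<lambda>x. q x - conv_pp q b x)"
    using Suc.IH[OF conv_pp_minus_in_Pol[OF assms(1) Suc.prems]] by blast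
  have "conv_pp (\<lambda>x. q x + p x) b = q" unfolding conv_pp_add p(2) by simp
  moreover have "(\<lambda>x. q x + p x) \<in> Pol (Suc m)" using Pol_add[OF Suc.prems Pol_mono[OF p(1)]] by simp
  ultimately show ?case by blast
qed

text \<open>The n-th coefficient of a polynomial of degree at most m is a combination of its values
  at 0, ..., m; the weights are the n-th coefficients of the Lagrange basis polynomials.\<close>

lemma lagrange_functional:
  "\<exists>w :: nat \<Rightarrow> complex. \<forall>j\<le>m. (\<Sum>k\<le>m. of_nat k ^ j * w k) = (if j = n then 1 else 0)"
proof -
  define L :: "nat \<Rightarrow> complex poly" where
    "L k = (\<Prod>j\<in>{..m} - {k}. smult (1 / (of_nat k - of_nat j)) [:- of_nat j, 1:])" for k
  have L: "poly (L k) (of_nat i) = (if i = k then 1 else 0)" if "i \<le> m" "k \<le> m" for i k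
  proof -
    have "poly (L k) (of_nat i) = (\<Prod>j\<in>{..m} - {k}. (of_nat i - of_nat j) / (of_nat k - of_nat j))"
      by (simp add: L_def poly_prod diff_divide_distrib)
    also have "\<dots> = (if i = k then 1 else 0)"
      using that by (auto intro!: prod.neutral)
    finally show ?thesis .
  qed
  have deg: "degree (L k) \<le> m" if "k \<le> m" for k
  proof -
    have "degree (L k) \<le> (\<Sum>j\<in>{..m} - {k}. degree (smult (1 / (of_nat k - of_nat j)) [:- of_nat j, 1 :: complex:]))"
      unfolding L_def by (rule order_trans[OF degree_prod_sum_le]) (simp_all add: o_def)
    also have "\<dots> \<le> (\<Sum>j\<in>{..m} - {k}. 1)" by (intro sum_mono) auto
    also have "\<dots> = m" using that by simp
    finally show ?thesis .
  qed
  \<comment> \<open>Interpolation reproduces the monomial: both sides have degree at most m and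
    agree at m + 1 nodes.\<close>
  have "monom 1 j = (\<Sum>k\<le>m. smult (of_nat k ^ j) (L k))" if "j \<le> m" for j
  proof (rule poly_eqI_degree)
    fix x :: complex assume "x \<in> of_nat ` {..m}"
    then obtain i where i: "x = of_nat i" "i \<le> m" by auto
    have "poly (\<Sum>k\<le>m. smult (of_nat k ^ j) (L k)) x = (\<Sum>k\<le>m. if k = i then of_nat i ^ j else 0)"
      unfolding poly_sum i by (intro sum.cong) (use L i in auto)
    also have "\<dots> = of_nat i ^ j" using i by simp
    finally show "poly (monom 1 j) x = poly (\<Sum>k\<le>m. smult (of_nat k ^ j) (L k)) x"
      by (simp add: poly_monom i)
  next
    have c: "card (of_nat ` {..m} :: complex set) = Suc m" by (subst card_image) (auto simp: inj_on_def)
    show "degree (monom (1::complex) j) < card (of_nat ` {..m} :: complex set)"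
      using that by (simp add: c degree_monom_eq)
    have "degree (\<Sum>k\<le>m. smult (of_nat k ^ j) (L k)) \<le> m"
      using deg by (intro degree_sum_le) (auto intro: order_trans[OF degree_smult_le])
    then show "degree (\<Sum>k\<le>m. smult (of_nat k ^ j) (L k)) < card (of_nat ` {..m} :: complex set)"
      by (simp add: c)
  qed
  then have "coeff (monom 1 j) n = (\<Sum>k\<le>m. of_nat k ^ j * coeff (L k) n)" if "j \<le> m" for j
    using that by (simp add: coeff_sum)
  then show ?thesis by (intro exI[of _ "\<lambda>k. coeff (L k) n"]) simp
qed

text \<open>Tensor products of the one-dimensional weights give functionals on a lattice grid dual
  to the divided monomials; w combines them with the values of \<Lambda> on that basis.\<close>

lemma functional_rep:
  fixes \<Lambda> :: "(real ^ 'd::finite \<Rightarrow> complex) \<Rightarrow> complex"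
  assumes add: "\<And>p q. p \<in> Pol m \<Longrightarrow> q \<in> Pol m \<Longrightarrow> \<Lambda> (\<lambda>x. p x + q x) = \<Lambda> p + \<Lambda> q"
    and scale: "\<And>c p. p \<in> Pol m \<Longrightarrow> \<Lambda> (\<lambda>x. c * p x) = c * \<Lambda> p"
  shows "\<exists>w. finite (supp w) \<and> (\<forall>p\<in>Pol m. \<Lambda> p = conv_pp p w 0)"
proof -
  define lag where "lag n = (SOME w :: nat \<Rightarrow> complex. \<forall>j\<le>m. (\<Sum>k\<le>m. of_nat k ^ j * w k) = (if j = n then 1 else 0))" for n
  have lag: "(\<Sum>k\<le>m. of_nat k ^ j * lag n k) = (if j = n then 1 else 0)" if "j \<le> m" for j n
    using someI_ex[OF lagrange_functional[of m n]] that unfolding lag_def by blast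
  \<comment> \<open>The nodes are negative because \<open>conv_pp p w 0\<close> evaluates p at
    \<open>- emb k\<close>.\<close>
  define B where "B = {k :: int ^ 'd. \<forall>i. k $ i \<in> uminus ` int ` {..m}}"
  have finB: "finite B" unfolding B_def by (rule finite_vec_box) simp
  \<comment> \<open>The factorials undo the normalization of \<open>dmono\<close>, since the weights
    \<open>lag\<close> are dual to plain powers.\<close>
  define W where "W \<mu> k = (\<Prod>i\<in>UNIV. (fact (\<mu> $ i) * lag (\<mu> $ i) (nat (- k $ i))))" for \<mu> :: "nat ^ 'd" and k :: "int ^ 'd"
  have dual: "(\<Sum>k\<in>B. dmono \<kappa> (- emb k) * W \<mu> k) = (if \<kappa> = \<mu> then 1 else 0)" if "mdeg \<kappa> \<le> m" for \<kappa> \<mu> :: "nat ^ 'd"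
  proof -
    have le: "\<kappa> $ i \<le> m" for i
      using that member_le_sum[of i UNIV "\<lambda>i. \<kappa> $ i"] by (simp add: mdeg_def)
    have "(\<Sum>k\<in>B. dmono \<kappa> (- emb k) * W \<mu> k) =
        (\<Prod>i\<in>UNIV. \<Sum>n\<in>uminus ` int ` {..m}. complex_of_real (- real_of_int n) ^ (\<kappa> $ i) / fact (\<kappa> $ i) * (fact (\<mu> $ i) * lag (\<mu> $ i) (nat (- n))))"
      unfolding B_def dmono_eq_prod W_def
      by (subst prod_sum_vec) (simp_all add: emb_def flip: prod.distrib)
    also have "\<dots> = (\<Prod>i\<in>UNIV. if \<kappa> $ i = \<mu> $ i then 1 else 0)"
    proof (intro prod.cong refl)
      fix i
      have "(\<Sum>n\<in>uminus ` int ` {..m}. complex_of_real (- real_of_int n) ^ (\<kappa> $ i) / fact (\<kappa> $ i) * (fact (\<mu> $ i) * lag (\<mu> $ i) (nat (- n))))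
          = (\<Sum>k\<le>m. of_nat k ^ (\<kappa> $ i) / fact (\<kappa> $ i) * (fact (\<mu> $ i) * lag (\<mu> $ i) k))"
        unfolding image_image by (subst sum.reindex) (auto simp: inj_on_def)
      also have "\<dots> = fact (\<mu> $ i) / fact (\<kappa> $ i) * (\<Sum>k\<le>m. of_nat k ^ (\<kappa> $ i) * lag (\<mu> $ i) k)"
        unfolding sum_distrib_left by (intro sum.cong) auto
      also have "\<dots> = (if \<kappa> $ i = \<mu> $ i then 1 else 0)" by (simp add: lag[OF le])
      finally show "(\<Sum>n\<in>uminus ` int ` {..m}. complex_of_real (- real_of_int n) ^ (\<kappa> $ i) / fact (\<kappa> $ i) * (fact (\<mu> $ i) * lag (\<mu> $ i) (nat (- n))))
          = (if \<kappa> $ i = \<mu> $ i then 1 else 0)" .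
    qed
    also have "\<dots> = (if \<kappa> = \<mu> then 1 else 0)" by (auto simp: vec_eq_iff)
    finally show ?thesis .
  qed
  define w where "w k = (if k \<in> B then \<Sum>\<mu> | mdeg \<mu> \<le> m. \<Lambda> (dmono \<mu>) * W \<mu> k else 0)" for k
  have sup: "supp w \<subseteq> B" by (auto simp: supp_def w_def)
  have "\<Lambda> p = conv_pp p w 0" if "p \<in> Pol m" for p
    using that
  proof (induction rule: Pol_induct)
    case zero
    show ?case using scale[OF Pol_zero, of 0] by (simp add: conv_pp_def)
  next
    case (step c \<mu> p)
    have "conv_pp (dmono \<mu>) w 0 = (\<Sum>k\<in>B. \<Sum>\<nu> | mdeg \<nu> \<le> m. \<Lambda> (dmono \<nu>) * (dmono \<mu> (- emb k) * W \<nu> k))"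
      unfolding conv_pp_superset[OF finB sup] by (simp add: w_def sum_distrib_left mult_ac)
    also have "\<dots> = (\<Sum>\<nu> | mdeg \<nu> \<le> m. \<Lambda> (dmono \<nu>) * (\<Sum>k\<in>B. dmono \<mu> (- emb k) * W \<nu> k))"
      unfolding sum_distrib_left by (rule sum.swap)
    also have "\<dots> = \<Lambda> (dmono \<mu>)"
      unfolding dual[OF step(1)] using step(1)
      by (simp add: finite_mdeg_le if_distrib[of "\<lambda>u. _ * u"] cong: if_cong)
    finally have "\<Lambda> (dmono \<mu>) = conv_pp (dmono \<mu>) w 0" by simp
    then show ?case
      using step by (simp add: add scale Pol_scale dmono_in_Pol conv_pp_add conv_pp_scale)
  qed
  moreover have "finite (supp w)" using finite_subset[OF sup finB] .
  ultimately show ?thesis by blast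
qed

text \<open>Injectivity makes g a function G of p that is linear and commutes with translations. The
  functional \<open>p \<mapsto> G p 0\<close> is given by a filter c, and translation carries this
  from 0 to every point.\<close>

lemma conv_pv_factor:
  fixes v w :: "int ^ 'd::finite \<Rightarrow> complex ^ 'r::finite"
  assumes v: "finite (supp v)" "vhat v 0 \<noteq> 0"
    and ex: "\<And>p. p \<in> Pol m \<Longrightarrow> \<exists>g\<in>Pol m. conv_pv p w = conv_pv g v"
  shows "\<exists>c. finite (supp c) \<and> (\<forall>p\<in>Pol m. conv_pv p w = conv_pv (conv_pp p c) v)"
proof -
  obtain G where G: "\<And>p. p \<in> Pol m \<Longrightarrow> G p \<in> Pol m \<and> conv_pv p w = conv_pv (G p) v"
    using ex by metis
  have uniq: "G p = g" if "p \<in> Pol m" "g \<in> Pol m" "conv_pv p w = conv_pv g v" for p g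
    using conv_pv_inj[OF v] G that by metis
  have "\<exists>c. finite (supp c) \<and> (\<forall>p\<in>Pol m. G p 0 = conv_pp p c 0)"
  proof (rule functional_rep)
    fix p q :: "real ^ 'd \<Rightarrow> complex" assume pq: "p \<in> Pol m" "q \<in> Pol m"
    have "G (\<lambda>x. p x + q x) = (\<lambda>x. G p x + G q x)"
      using pq G by (intro uniq Pol_add) (simp_all add: conv_pv_add)
    then show "G (\<lambda>x. p x + q x) 0 = G p 0 + G q 0" by simp
  next
    fix c and p :: "real ^ 'd \<Rightarrow> complex" assume p: "p \<in> Pol m"
    have "G (\<lambda>x. c * p x) = (\<lambda>x. c * G p x)"
      using p G by (intro uniq Pol_scale) (simp_all add: conv_pv_scale)
    then show "G (\<lambda>x. c * p x) 0 = c * G p 0" by simp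
  qed
  then obtain c where c: "finite (supp c)" "\<And>p. p \<in> Pol m \<Longrightarrow> G p 0 = conv_pp p c 0" by blast
  have "G p x = conv_pp p c x" if p: "p \<in> Pol m" for p x
  proof -
    have "G (\<lambda>z. p (z - (- x))) = (\<lambda>z. G p (z - (- x)))"
    proof (rule uniq)
      show "conv_pv (\<lambda>z. p (z - (- x))) w = conv_pv (\<lambda>z. G p (z - (- x))) v"
        unfolding conv_pv_shift using G[OF p] by simp
    qed (use G[OF p] p Pol_shift in blast)+
    moreover have "G (\<lambda>z. p (z - (- x))) 0 = conv_pp (\<lambda>z. p (z - (- x))) c 0"
      by (rule c(2)[OF Pol_shift[OF p]])
    ultimately show ?thesis unfolding conv_pp_shift by simp
  qed
  then have "G p = conv_pp p c" if "p \<in> Pol m" for p using that by blast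
  then show ?thesis using c(1) G by metis
qed

text \<open>
  On the Fourier side the equation is \<open>fhat b (2 \<xi>) * fhat c \<xi> = fhat b \<xi>\<close> up to order m at the origin.
  It is solved degree by degree: on the polynomials of the next degree the defect is a constant, hence
  a linear functional, and it is removed by a filter u that annihilates all lower degrees.
\<close>

lemma exists_refinable_filter:
  fixes c :: "int ^ 'd::finite \<Rightarrow> complex"
  assumes c: "fhat c 0 = 1"
  shows "\<exists>b. finite (supp b) \<and> fhat b 0 = 1 \<and>
    (\<forall>p\<in>Pol m. conv_pp (\<lambda>x. conv_pp p b ((1/2) *\<^sub>R x)) c = conv_pp (\<lambda>x. p ((1/2) *\<^sub>R x)) b)"
proof (induction m)
  case 0
  define b where "b k = (if k = 0 then 1 else 0 :: complex)" for k :: "int ^ 'd"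
  have "supp b = {0}" by (auto simp: supp_def b_def)
  then have b: "finite (supp b)" "fhat b 0 = 1" by (simp_all add: fhat_0 b_def)
  have "conv_pp (\<lambda>x. conv_pp p b ((1/2) *\<^sub>R x)) c = conv_pp (\<lambda>x. p ((1/2) *\<^sub>R x)) b"
    if p: "p \<in> Pol 0" for p
  proof -
    obtain e where "p = (\<lambda>x. e)" using Pol_0D[OF p] by blast
    then show ?thesis by (simp add: conv_pp_const b c)
  qed
  with b show ?case by blast
next
  case (Suc m)
  then obtain b where b: "finite (supp b)" "fhat b 0 = 1"
    and eq: "\<And>p. p \<in> Pol m \<Longrightarrow> conv_pp (\<lambda>x. conv_pp p b ((1/2) *\<^sub>R x)) c = conv_pp (\<lambda>x. p ((1/2) *\<^sub>R x)) b"
    by blast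
  \<comment> \<open>The defect of b in the equation.\<close>
  define E where "E p x = conv_pp (\<lambda>x. conv_pp p b ((1/2) *\<^sub>R x)) c x - conv_pp (\<lambda>x. p ((1/2) *\<^sub>R x)) b x" for p x
  have E_add: "E (\<lambda>x. p x + q x) x = E p x + E q x" for p q x
    by (simp add: E_def conv_pp_add)
  have E_diff: "E (\<lambda>x. p x - q x) x = E p x - E q x" for p q x
    by (simp add: E_def conv_pp_diff)
  have E_scale: "E (\<lambda>x. e * p x) x = e * E p x" for e p x
    by (simp add: E_def conv_pp_scale ring_distribs)
  \<comment> \<open>Because of the argument x/2, a translation of p by y translates the defect by
    2y.\<close>
  have E_shift: "E (\<lambda>x. p (x - y)) x = E p (x - 2 *\<^sub>R y)" for p y x
  proof -
    have "(1/2) *\<^sub>R x - y = (1/2) *\<^sub>R (x - 2 *\<^sub>R y)" for x :: "real ^ 'd" by (simp add: algebra_simps)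
    then have "conv_pp (\<lambda>x. f ((1/2) *\<^sub>R x - y)) w x = conv_pp (\<lambda>x. f ((1/2) *\<^sub>R x)) w (x - 2 *\<^sub>R y)" for f w
      using conv_pp_shift[of "\<lambda>x. f ((1/2) *\<^sub>R x)" "2 *\<^sub>R y" w] by simp
    then show ?thesis unfolding E_def conv_pp_shift by simp
  qed
  have E_0: "E p x = 0" if "p \<in> Pol m" for p x
    using eq[OF that] by (simp add: E_def)
  \<comment> \<open>Differences of p have degree at most m, hence no defect, so \<open>E p\<close>
    is translation invariant. The shift x/2 becomes x and carries x to 0.\<close>
  have E_const: "E p x = E p 0" if "p \<in> Pol (Suc m)" for p x
    using E_0[OF Pol_Suc_shift_diff[OF that], of "(1/2) *\<^sub>R x" x] by (simp add: E_diff E_shift)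
  \<comment> \<open>Adding u to b adds the constant \<open>\<kappa> * E p 0\<close> on the left,
    where c preserves it, and \<open>(1/2) ^ Suc m\<close> times it on the right. The defect
    vanishes when \<open>1 + \<kappa> * (1 - (1/2) ^ Suc m) = 0\<close>.\<close>
  define \<kappa> :: complex where "\<kappa> = - 1 / (1 - (1/2) ^ Suc m)"
  have "\<exists>u. finite (supp u) \<and> (\<forall>p\<in>Pol (Suc m). \<kappa> * E p 0 = conv_pp p u 0)"
    by (rule functional_rep) (simp_all add: E_add E_scale ring_distribs)
  then obtain u where u: "finite (supp u)" "\<And>p. p \<in> Pol (Suc m) \<Longrightarrow> conv_pp p u 0 = \<kappa> * E p 0" by metis
  have u_0: "conv_pp p u 0 = 0" if "p \<in> Pol m" for p
    using u(2)[OF Pol_mono[OF that]] E_0[OF that] by simp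
  have u_const: "conv_pp p u = (\<lambda>x. \<kappa> * E p 0)" if "p \<in> Pol (Suc m)" for p
  proof
    fix x
    have "conv_pp p u x = conv_pp p u 0"
      using u_0[OF Pol_Suc_shift_diff[OF that], of "- x"] by (simp add: conv_pp_diff conv_pp_shift[of p "- x", simplified])
    then show "conv_pp p u x = \<kappa> * E p 0" using u(2)[OF that] by simp
  qed
  \<comment> \<open>Up to lower degrees, which u annihilates, dilation multiplies p by
    \<open>(1/2) ^ Suc m\<close>.\<close>
  have u_dilate: "conv_pp (\<lambda>x. p ((1/2) *\<^sub>R x)) u x = (1/2) ^ Suc m * (\<kappa> * E p 0)" if "p \<in> Pol (Suc m)" for p x
  proof -
    have "conv_pp (\<lambda>x. p ((1/2) *\<^sub>R x)) u x = conv_pp (\<lambda>x. p ((1/2) *\<^sub>R x)) u 0"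
      unfolding u_const[OF Pol_dilate[OF that]] ..
    also have "\<dots> = (1/2) ^ Suc m * conv_pp p u 0"
      using u_0[OF Pol_Suc_dilate_diff[OF that, of "1/2"]] unfolding conv_pp_diff conv_pp_scale
      by (simp del: power_Suc)
    finally show ?thesis unfolding u_const[OF that] .
  qed
  define b' where "b' k = b k + u k" for k
  have b': "conv_pp p b' x = conv_pp p b x + conv_pp p u x" for p x
    unfolding b'_def by (rule conv_pp_add_right[OF b(1) u(1)])
  have "finite (supp b')"
    by (rule finite_subset[of _ "supp b \<union> supp u"]) (use b(1) u(1) in \<open>auto simp: supp_def b'_def\<close>)
  moreover have "fhat b' 0 = 1"
    using b'[of "\<lambda>x. 1" 0] u_0[OF Pol_const, of 1] b(2) by (simp add: conv_pp_const)
  moreover have "conv_pp (\<lambda>x. conv_pp p b' ((1/2) *\<^sub>R x)) c = conv_pp (\<lambda>x. p ((1/2) *\<^sub>R x)) b'"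
    if p: "p \<in> Pol (Suc m)" for p
  proof
    fix x
    have "conv_pp (\<lambda>x. conv_pp p b' ((1/2) *\<^sub>R x)) c x - conv_pp (\<lambda>x. p ((1/2) *\<^sub>R x)) b' x
        = E p x + \<kappa> * E p 0 - (1/2) ^ Suc m * (\<kappa> * E p 0)"
      unfolding b' u_const[OF p] u_dilate[OF p] conv_pp_add conv_pp_const c E_def by simp
    also have "\<dots> = (1 + \<kappa> * (1 - (1/2) ^ Suc m)) * E p 0"
      unfolding E_const[OF p, of x] by (simp add: algebra_simps)
    also have "\<kappa> * (1 - (1/2) ^ Suc m) = - 1"
    proof -
      have "norm ((1/2 :: complex) ^ Suc m) < 1" unfolding norm_power by (rule power_Suc_less_one) simp_all
      then have "(1 :: complex) - (1/2) ^ Suc m \<noteq> 0" by force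
      then show ?thesis unfolding \<kappa>_def by simp
    qed
    finally show "conv_pp (\<lambda>x. conv_pp p b' ((1/2) *\<^sub>R x)) c x = conv_pp (\<lambda>x. p ((1/2) *\<^sub>R x)) b' x"
      by simp
  qed
  ultimately show ?case by blast
qed

section \<open>Linearity of subdivision and of restriction to the lattice\<close>

lemma subdiv_add: "subdiv a (\<lambda>k. u k + w k) = (\<lambda>j. subdiv a u j + subdiv a w j)"
  for a :: "int ^ 'd::finite \<Rightarrow> complex ^ 'r::finite ^ 'r"
  by (simp add: subdiv_def fun_eq_iff vec_eq_iff vector_matrix_mult_def ring_distribs sum.distrib)

lemma subdiv_scale: "subdiv a (\<lambda>k. c *s u k) = (\<lambda>j. c *s subdiv a u j)"
  for a :: "int ^ 'd::finite \<Rightarrow> complex ^ 'r::finite ^ 'r"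
  by (simp add: subdiv_def fun_eq_iff vec_eq_iff scalar_vector_matrix_assoc sum_distrib_left mult_ac)

lemma subdiv_zero: "subdiv a (\<lambda>k. 0) = (\<lambda>j. 0)"
  for a :: "int ^ 'd::finite \<Rightarrow> complex ^ 'r::finite ^ 'r"
  by (simp add: subdiv_def fun_eq_iff vec_eq_iff)

lemma restr_add: "restr (\<lambda>x. f x + g x) = (\<lambda>k. restr f k + restr g k)"
  by (simp add: restr_def)

lemma restr_scale: "restr (\<lambda>x. c *s f x) = (\<lambda>k. c *s restr f k)"
  by (simp add: restr_def)

lemma restr_zero: "restr (\<lambda>x. 0) = (\<lambda>k. 0)"
  by (simp add: restr_def)

lemma subdiv_eq_conv_ring_seq:
  fixes a :: "int ^ 'd::finite \<Rightarrow> complex ^ 'r::finite ^ 'r"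
  assumes "finite (supp a)" "finite (supp v)" "p \<in> Pol m" "g \<in> vPol n"
    and "subdiv a (restr (conv_pv p v)) = restr g"
  shows "conv_pv (\<lambda>x. p ((1/2) *\<^sub>R x)) (ring_seq a v) = g"
  using assms(5) unfolding subdiv_eq_poly_iff[OF assms(1-4)] by blast

text \<open>Halving the argument is a bijection of \<open>Pol m\<close>, with doubling as its
  inverse.\<close>

lemma ball_Pol_dilate:
  fixes Q :: "(real ^ 'd::finite \<Rightarrow> complex) \<Rightarrow> bool"
  shows "(\<forall>p\<in>Pol m. Q (\<lambda>x. p ((1/2) *\<^sub>R x))) \<longleftrightarrow> (\<forall>p\<in>Pol m. Q p)"
proof (intro iffI ballI)
  fix p :: "real ^ 'd \<Rightarrow> complex"
  assume "\<forall>p\<in>Pol m. Q (\<lambda>x. p ((1/2) *\<^sub>R x))" "p \<in> Pol m"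
  from bspec[OF this(1) Pol_dilate[OF this(2), of 2]] show "Q p" by simp
qed (use Pol_dilate in blast)

text \<open>The bridge between the Fourier side and subdivision: \<open>z = y\<close> gives the sum
  rules, and \<open>z = conv_sv c y\<close> gives the version with a filter c.\<close>

lemma eq_order_conditions_iff:
  fixes a :: "int ^ 'd::finite \<Rightarrow> complex ^ 'r::finite ^ 'r"
  assumes fin: "finite (supp a)" "finite (supp y)" and z: "finite (supp z)"
  shows "eq_order (m + 1) (\<lambda>\<xi>. vhat y (2 *\<^sub>R \<xi>) v* mhat a \<xi>) (vhat z) \<and>
      (\<forall>\<omega>\<in>Gam - {0}. eq_order (m + 1) (\<lambda>\<xi>. vhat y (2 *\<^sub>R \<xi>) v* mhat a (\<xi> + pi *\<^sub>R emb \<omega>)) (\<lambda>\<xi>. 0)) \<longleftrightarrow>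
    (\<forall>p\<in>Pol m. subdiv a (restr (conv_pv p y)) = restr (conv_pv (\<lambda>x. p ((1/2) *\<^sub>R x)) z))"
proof -
  have zero: "(\<lambda>\<xi>. 0) = vhat (\<lambda>k :: int ^ 'd. 0 :: complex ^ 'r)" "finite (supp (\<lambda>k :: int ^ 'd. 0 :: complex ^ 'r))"
    by (auto simp: fun_eq_iff vhat_def fhat_def supp_def vec_eq_iff)
  have tw: "finite (supp (twist \<omega> (ring_seq a y)))" for \<omega>
    unfolding supp_twist by (rule finite_supp_ring_seq[OF fin])
  have tw_iff: "eq_order (Suc m) (vhat (twist \<omega> (ring_seq a y))) (\<lambda>\<xi>. 0) \<longleftrightarrow>
      (\<forall>p\<in>Pol m. conv_pv p (twist \<omega> (ring_seq a y)) = (\<lambda>x. 0))" for \<omega>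
    using eq_order_vhat_iff[OF tw zero(2), of m \<omega>] by (simp only: zero(1)[symmetric] conv_pv_zero_right)
  have *: "(\<lambda>\<xi>. vhat y (2 *\<^sub>R \<xi>) v* mhat a \<xi>) = vhat (ring_seq a y)"
    using vhat_twist_ring_seq[OF fin, of _ 0] by (simp add: fun_eq_iff emb_0 twist_0)
  have "eq_order (m + 1) (\<lambda>\<xi>. vhat y (2 *\<^sub>R \<xi>) v* mhat a \<xi>) (vhat z) \<and>
      (\<forall>\<omega>\<in>Gam - {0}. eq_order (m + 1) (\<lambda>\<xi>. vhat y (2 *\<^sub>R \<xi>) v* mhat a (\<xi> + pi *\<^sub>R emb \<omega>)) (\<lambda>\<xi>. 0)) \<longleftrightarrow>
    (\<forall>p\<in>Pol m. (\<forall>\<omega>\<in>Gam - {0}. conv_pv p (twist \<omega> (ring_seq a y)) = (\<lambda>x. 0)) \<and>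
      conv_pv p (ring_seq a y) = conv_pv p z)"
    unfolding * vhat_twist_ring_seq[OF fin] Suc_eq_plus1[symmetric] tw_iff
      eq_order_vhat_iff[OF finite_supp_ring_seq[OF fin] z]
    by blast
  also have "\<dots> \<longleftrightarrow> (\<forall>p\<in>Pol m. subdiv a (restr (conv_pv p y)) = restr (conv_pv (\<lambda>x. p ((1/2) *\<^sub>R x)) z))"
    unfolding ball_Pol_dilate[symmetric, of m "\<lambda>p. (\<forall>\<omega>\<in>Gam - {0}. conv_pv p (twist \<omega> (ring_seq a y)) = (\<lambda>x. 0)) \<and>
      conv_pv p (ring_seq a y) = conv_pv p z"]
    using subdiv_eq_poly_iff[OF fin _ conv_pv_vPol[OF Pol_dilate]] by blast
  finally show ?thesis .
qed

text \<open>The missing degree is added to a single exponent. This is why conditions on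
  multi-indices of degree exactly m control all lower degrees.\<close>

lemma exists_dmono_antiderivative:
  fixes \<mu> :: "nat ^ 'd::finite"
  assumes "mdeg \<mu> \<le> m"
  shows "\<exists>\<kappa> \<nu>. mdeg \<kappa> = m \<and> mderiv \<nu> (dmono \<kappa>) = dmono \<mu>"
proof -
  \<comment> \<open>Picks some coordinate; the index type is nonempty.\<close>
  obtain i :: 'd where True by blast
  define \<nu> where "\<nu> = (\<chi> j. if j = i then m - mdeg \<mu> else 0)"
  have "mdeg \<nu> = m - mdeg \<mu>" by (simp add: mdeg_def \<nu>_def)
  then have "mdeg (\<mu> + \<nu>) = m" using assms by (simp add: mdeg_add)
  moreover have "mderiv \<nu> (dmono (\<mu> + \<nu>)) = dmono \<mu>"
    by (simp add: mderiv_dmono less_eq_vec_def)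
  ultimately show ?thesis by blast
qed

lemma mderiv_0: "mderiv 0 f = f"
  for f :: "real ^ 'd::finite \<Rightarrow> 'a::real_normed_vector"
  using length_mlist[of "0 :: nat ^ 'd"] by (simp add: mderiv_eq_foldr mdeg_def)

lemma pol_ext_restr:
  fixes q :: "real ^ 'd::finite \<Rightarrow> complex ^ 'r"
  assumes "q \<in> vPol n"
  shows "pol_ext (restr q) = q"
  unfolding pol_ext_def
proof (rule the_equality)
  fix q' :: "real ^ 'd \<Rightarrow> complex ^ 'r"
  assume "(\<exists>n. q' \<in> vPol n) \<and> restr q' = restr q"
  then obtain n' where q': "q' \<in> vPol n'" "restr q' = restr q" by blast
  have "(\<lambda>x. q' x $ j - q x $ j) = (\<lambda>x. 0)" for j
  proof (rule Pol_zero_on_lattice)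
    have "(\<lambda>x. q' x $ j) \<in> Pol n'" "(\<lambda>x. q x $ j) \<in> Pol n"
      using q'(1) assms unfolding vPol_def by blast+
    from Pol_diff[OF Pol_mono[OF this(1), of "n' + n"] Pol_mono[OF this(2), of "n' + n"]]
    show "(\<lambda>x. q' x $ j - q x $ j) \<in> Pol (n' + n)" by simp
    show "q' (emb k) $ j - q (emb k) $ j = 0" for k
      using fun_cong[OF q'(2), of k] by (simp add: restr_def)
  qed
  then show "q' = q" by (simp add: fun_eq_iff vec_eq_iff)
qed (use assms in blast)

text \<open>The polynomial g, of arbitrary degree bound n, is identified with a convolution with
  \<open>ring_seq a v\<close>, which improves the bound to m. Both occurrences of
  \<open>pol_ext\<close> are then evaluated on explicit polynomials.\<close>

lemma mderiv_pol_ext_subdiv: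
  fixes a :: "int ^ 'd::finite \<Rightarrow> complex ^ 'r::finite ^ 'r"
  assumes fin: "finite (supp a)" "finite (supp v)" and p: "p \<in> Pol m" and g: "g \<in> vPol n"
    and eq: "subdiv a (restr (conv_pv p v)) = restr g"
  shows "subdiv a (restr (conv_pv p v)) \<in> restr ` vPol m"
    and "mderiv \<nu> (pol_ext (subdiv a (restr (conv_pv p v)))) =
      fscale ((1/2) ^ mdeg \<nu>) (pol_ext (subdiv a (restr (conv_pv (mderiv \<nu> p) v))))"
proof -
  have g_eq: "g = conv_pv (\<lambda>x. p ((1/2) *\<^sub>R x)) (ring_seq a v)"
    using subdiv_eq_conv_ring_seq[OF fin p g eq] by simp
  then have gm: "g \<in> vPol m" using conv_pv_vPol[OF Pol_dilate[OF p]] by simp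
  then show "subdiv a (restr (conv_pv p v)) \<in> restr ` vPol m" unfolding eq by blast
  have "(\<lambda>x. 2 ^ mdeg \<nu> *s mderiv \<nu> g x) = conv_pv (\<lambda>x. 2 ^ mdeg \<nu> * mderiv \<nu> (\<lambda>x. p ((1/2) *\<^sub>R x)) x) (ring_seq a v)"
    unfolding g_eq mderiv_conv_pv[OF smooth_Pol[OF Pol_dilate[OF p]]] conv_pv_scale ..
  then have "(\<lambda>x. 2 ^ mdeg \<nu> *s mderiv \<nu> g x) \<in> vPol (m - mdeg \<nu>)"
    using p by (auto intro!: conv_pv_vPol Pol_scale mderiv_in_Pol Pol_dilate)
  then have "pol_ext (subdiv a (restr (conv_pv (mderiv \<nu> p) v))) = (\<lambda>x. 2 ^ mdeg \<nu> *s mderiv \<nu> g x)"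
    unfolding subdiv_mderiv[OF fin p g eq] by (rule pol_ext_restr)
  then show "mderiv \<nu> (pol_ext (subdiv a (restr (conv_pv p v)))) =
      fscale ((1/2) ^ mdeg \<nu>) (pol_ext (subdiv a (restr (conv_pv (mderiv \<nu> p) v))))"
    unfolding eq pol_ext_restr[OF g] by (simp add: fscale_def fun_eq_iff vec_eq_iff power_one_over)
qed

text \<open>The addition formula at \<open>x - emb k\<close> separates x from k; summed over k, the
  powers of k are moments of y, that is, derivatives of its Fourier series at 0.\<close>

lemma conv_pv_dmono:
  fixes y :: "int ^ 'd::finite \<Rightarrow> complex ^ 'r::finite"
  assumes "finite (supp y)"
  shows "conv_pv (dmono \<mu>) y x = (\<Sum>\<nu> | \<nu> \<le> \<mu>.
    ((- \<i>) ^ mdeg \<nu> / of_nat (mfact \<nu> * mfact (\<mu> - \<nu>)) * mpow x (\<mu> - \<nu>)) *s mderiv \<nu> (vhat y) 0)"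
proof -
  have 1: "dmono \<mu> (x - emb k) = (\<Sum>\<nu> | \<nu> \<le> \<mu>.
      (- \<i>) ^ mdeg \<nu> / of_nat (mfact \<nu> * mfact (\<mu> - \<nu>)) * mpow x (\<mu> - \<nu>) * ((- \<i>) ^ mdeg \<nu> * mpow (emb k) \<nu>))" for k
  proof -
    have "dmono \<mu> (x - emb k) = (\<Sum>\<nu> | \<nu> \<le> \<mu>. dmono (\<mu> - \<nu>) x * dmono \<nu> ((- 1) *\<^sub>R emb k))"
      using dmono_add[of \<mu> x "- emb k"] by simp
    also have "\<dots> = (\<Sum>\<nu> | \<nu> \<le> \<mu>.
      (- \<i>) ^ mdeg \<nu> / of_nat (mfact \<nu> * mfact (\<mu> - \<nu>)) * mpow x (\<mu> - \<nu>) * ((- \<i>) ^ mdeg \<nu> * mpow (emb k) \<nu>))"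
    proof (intro sum.cong refl)
      fix \<nu> assume "\<nu> \<in> {\<nu>. \<nu> \<le> \<mu>}"
      \<comment> \<open>One factor is explicit in the formula, the other comes from differentiating
        exponentials; together they give the sign of the powers of \<open>- emb k\<close>.\<close>
      have "(- \<i>) ^ mdeg \<nu> * (- \<i>) ^ mdeg \<nu> = (- 1) ^ mdeg \<nu>"
        by (simp flip: power_mult_distrib)
      then show "dmono (\<mu> - \<nu>) x * dmono \<nu> ((- 1) *\<^sub>R emb k) =
          (- \<i>) ^ mdeg \<nu> / of_nat (mfact \<nu> * mfact (\<mu> - \<nu>)) * mpow x (\<mu> - \<nu>) * ((- \<i>) ^ mdeg \<nu> * mpow (emb k) \<nu>)"
        unfolding dmono_scaleR by (simp add: dmono_def field_simps)
    qed
    finally show ?thesis .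
  qed
  show ?thesis
    unfolding conv_pv_def 1 mderiv_vhat[OF assms] fker_0
    by (simp add: vec_eq_iff sum_distrib_left sum_distrib_right mult.assoc sum.swap[of _ "supp y"])
qed

section \<open>The six conditions\<close>

text \<open>This and the following predicates repeat the propositions of the final theorem
  literally, so that unfolding them closes its proof.\<close>

definition normalized :: "(int ^ 'd::finite \<Rightarrow> complex) \<Rightarrow> bool" where
  "normalized b \<longleftrightarrow> finite (supp b) \<and> fhat b 0 = 1"

definition matching ::
    "nat \<Rightarrow> (int ^ 'd::finite \<Rightarrow> complex ^ 'r ^ 'r) \<Rightarrow> (int ^ 'd \<Rightarrow> complex ^ 'r) \<Rightarrow> (int ^ 'd \<Rightarrow> complex) \<Rightarrow> bool" where
  "matching m a v b \<longleftrightarrow> normalized b \<and> sum_rules (m + 1) a (conv_sv b v)"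

definition cond1 ::
    "nat \<Rightarrow> (int ^ 'd::finite \<Rightarrow> complex ^ 'r ^ 'r) \<Rightarrow> (int ^ 'd \<Rightarrow> complex ^ 'r) \<Rightarrow> bool" where
  "cond1 m a v \<longleftrightarrow> subdiv a ` restr ` PolV m v = restr ` PolV m v \<and>
    subdiv a (\<lambda>_. vhat v 0) = (\<lambda>_. vhat v 0)"

definition cond2 ::
    "nat \<Rightarrow> (int ^ 'd::finite \<Rightarrow> complex ^ 'r ^ 'r) \<Rightarrow> (int ^ 'd \<Rightarrow> complex ^ 'r) \<Rightarrow> bool" where
  "cond2 m a v \<longleftrightarrow> (\<exists>c. finite (supp c) \<and> fhat c 0 = 1 \<and>
    eq_order (m + 1) (\<lambda>\<xi>. vhat v (2 *\<^sub>R \<xi>) v* mhat a \<xi>) (\<lambda>\<xi>. fhat c \<xi> *s vhat v \<xi>) \<and>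
    (\<forall>\<omega>\<in>Gam - {0}.
      eq_order (m + 1) (\<lambda>\<xi>. vhat v (2 *\<^sub>R \<xi>) v* mhat a (\<xi> + pi *\<^sub>R emb \<omega>)) (\<lambda>\<xi>. 0)))"

definition cond3 ::
    "nat \<Rightarrow> (int ^ 'd::finite \<Rightarrow> complex ^ 'r ^ 'r) \<Rightarrow> (int ^ 'd \<Rightarrow> complex ^ 'r) \<Rightarrow> bool" where
  "cond3 m a v \<longleftrightarrow> (\<exists>b. matching m a v b)"

definition cond4 ::
    "nat \<Rightarrow> (int ^ 'd::finite \<Rightarrow> complex ^ 'r ^ 'r) \<Rightarrow> (int ^ 'd \<Rightarrow> complex ^ 'r) \<Rightarrow> bool" where
  "cond4 m a v \<longleftrightarrow> (\<exists>b. normalized b \<and> (\<forall>\<mu>. mdeg \<mu> \<le> m \<longrightarrow>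
    subdiv a (restr (conv_pv (dmono \<mu>) (conv_sv b v))) =
    fscale ((1/2) ^ mdeg \<mu>) (restr (conv_pv (dmono \<mu>) (conv_sv b v)))))"

definition cond5 ::
    "nat \<Rightarrow> (int ^ 'd::finite \<Rightarrow> complex ^ 'r::finite ^ 'r) \<Rightarrow> (int ^ 'd \<Rightarrow> complex ^ 'r) \<Rightarrow> bool" where
  "cond5 m a v \<longleftrightarrow> (\<exists>q :: nat ^ 'd \<Rightarrow> real ^ 'd \<Rightarrow> complex ^ 'r.
    (\<forall>\<mu>. mdeg \<mu> = m \<longrightarrow> q \<mu> \<in> vPol m \<and>
      subdiv a (restr (q \<mu>)) = fscale ((1/2) ^ mdeg \<mu>) (restr (q \<mu>))) \<and>
    fun_vs.span {mderiv \<nu> (q \<mu>) | \<mu> \<nu>. mdeg \<mu> = m} = PolV m v)"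

definition cond6 ::
    "nat \<Rightarrow> (int ^ 'd::finite \<Rightarrow> complex ^ 'r ^ 'r) \<Rightarrow> (int ^ 'd \<Rightarrow> complex ^ 'r) \<Rightarrow> bool" where
  "cond6 m a v \<longleftrightarrow> subdiv a (\<lambda>_. vhat v 0) = (\<lambda>_. vhat v 0) \<and>
    (\<forall>\<mu>. mdeg \<mu> = m \<longrightarrow> subdiv a (restr (conv_pv (dmono \<mu>) v)) \<in> restr ` PolV m v)"

lemma vhat_conv_sv_0: "normalized b \<Longrightarrow> finite (supp v) \<Longrightarrow> vhat (conv_sv b v) 0 = vhat v 0"
  by (simp add: normalized_def vhat_conv_sv)

lemma PolV_I: "p \<in> Pol m \<Longrightarrow> conv_pv p v \<in> PolV m v"
  by (auto simp: PolV_def)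

lemma PolV_subspace: "fun_vs.subspace (PolV m v)"
  for v :: "int ^ 'd::finite \<Rightarrow> complex ^ 'r"
proof (rule fun_vs.subspaceI)
  show "0 \<in> PolV m v" using PolV_I[OF Pol_zero[of m], of v] by (simp add: conv_pv_zero zero_fun_def)
next
  fix f g assume "f \<in> PolV m v" "g \<in> PolV m v"
  then obtain p q where "p \<in> Pol m" "q \<in> Pol m" "f = conv_pv p v" "g = conv_pv q v" by (auto simp: PolV_def)
  then show "f + g \<in> PolV m v"
    using PolV_I[OF Pol_add, of p m q] by (simp add: conv_pv_add plus_fun_def)
next
  fix c f assume "f \<in> PolV m v"
  then obtain p where "p \<in> Pol m" "f = conv_pv p v" by (auto simp: PolV_def)
  then show "fscale c f \<in> PolV m v"
    using PolV_I[OF Pol_scale, of p m] by (simp add: conv_pv_scale fscale_def)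
qed

section \<open>Implications between the conditions for a fixed mask and filter\<close>

context
  fixes a :: "int ^ 'd::finite \<Rightarrow> complex ^ 'r::finite ^ 'r"
    and v :: "int ^ 'd \<Rightarrow> complex ^ 'r"
    and m :: nat
  assumes fin_a: "finite (supp a)" and fin_v: "finite (supp v)" and v0: "vhat v 0 \<noteq> 0"
begin

lemma const_eq_conv_pv: "(\<lambda>_. vhat v 0) = restr (conv_pv (\<lambda>x. 1) v)"
  by (simp add: conv_pv_const[OF fin_v] restr_def fun_eq_iff vec_eq_iff)

lemma cond2_iff:
  "cond2 m a v \<longleftrightarrow> (\<exists>c. finite (supp c) \<and> fhat c 0 = 1 \<and>
    (\<forall>p\<in>Pol m. subdiv a (restr (conv_pv p v)) = restr (conv_pv (conv_pp (\<lambda>x. p ((1/2) *\<^sub>R x)) c) v)))"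
proof -
  have "eq_order (m + 1) (\<lambda>\<xi>. vhat v (2 *\<^sub>R \<xi>) v* mhat a \<xi>) (\<lambda>\<xi>. fhat c \<xi> *s vhat v \<xi>) \<and>
      (\<forall>\<omega>\<in>Gam - {0}. eq_order (m + 1) (\<lambda>\<xi>. vhat v (2 *\<^sub>R \<xi>) v* mhat a (\<xi> + pi *\<^sub>R emb \<omega>)) (\<lambda>\<xi>. 0)) \<longleftrightarrow>
      (\<forall>p\<in>Pol m. subdiv a (restr (conv_pv p v)) = restr (conv_pv (conv_pp (\<lambda>x. p ((1/2) *\<^sub>R x)) c) v))"
    if c: "finite (supp c)" for c
    using eq_order_conditions_iff[OF fin_a fin_v finite_supp_conv_sv[OF c fin_v], of m]
    unfolding conv_pv_conv_sv[OF c fin_v] vhat_conv_sv[OF c fin_v, abs_def] .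
  note * = this
  show ?thesis
    unfolding cond2_def
  proof (rule ex_cong1, rule conj_cong[OF refl], rule conj_cong[OF refl])
  qed (rule *)
qed

lemma matching_iff:
  "matching m a v b \<longleftrightarrow> normalized b \<and> (\<forall>p\<in>Pol m.
    subdiv a (restr (conv_pv p (conv_sv b v))) = restr (conv_pv (\<lambda>x. p ((1/2) *\<^sub>R x)) (conv_sv b v)))"
proof (cases "normalized b")
  case True
  then have "finite (supp (conv_sv b v))" "vhat (conv_sv b v) 0 \<noteq> 0"
    using fin_v v0 by (simp_all add: vhat_conv_sv_0 finite_supp_conv_sv normalized_def)
  then show ?thesis
    unfolding matching_def sum_rules_def using eq_order_conditions_iff[OF fin_a _ , of "conv_sv b v" "conv_sv b v" m]
    by (simp only: simp_thms)
qed (simp add: matching_def)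

text \<open>On divided monomials the dilation is multiplication by
  \<open>(1/2) ^ mdeg \<mu>\<close>, which turns the sum rules into eigenvalue equations; linearity
  gives the converse.\<close>

lemma matching_iff_dmono:
  "matching m a v b \<longleftrightarrow> normalized b \<and> (\<forall>\<mu>. mdeg \<mu> \<le> m \<longrightarrow>
    subdiv a (restr (conv_pv (dmono \<mu>) (conv_sv b v))) =
    fscale ((1/2) ^ mdeg \<mu>) (restr (conv_pv (dmono \<mu>) (conv_sv b v))))"
proof -
  define y where "y = conv_sv b v"
  have d: "(\<lambda>x. dmono \<mu> ((1/2) *\<^sub>R x)) = (\<lambda>x. (1/2) ^ mdeg \<mu> * dmono \<mu> x)" for \<mu> :: "nat ^ 'd"
    by (simp add: dmono_scaleR fun_eq_iff)
  have r: "restr (conv_pv (\<lambda>x. dmono \<mu> ((1/2) *\<^sub>R x)) y) = fscale ((1/2) ^ mdeg \<mu>) (restr (conv_pv (dmono \<mu>) y))" for \<mu>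
    unfolding d conv_pv_scale restr_scale fscale_def ..
  have "(\<forall>p\<in>Pol m. subdiv a (restr (conv_pv p y)) = restr (conv_pv (\<lambda>x. p ((1/2) *\<^sub>R x)) y)) \<longleftrightarrow>
    (\<forall>\<mu>. mdeg \<mu> \<le> m \<longrightarrow> subdiv a (restr (conv_pv (dmono \<mu>) y)) = restr (conv_pv (\<lambda>x. dmono \<mu> ((1/2) *\<^sub>R x)) y))"
    (is "?L \<longleftrightarrow> ?R")
  proof
    assume R: ?R
    show ?L
    proof
      fix p :: "real ^ 'd \<Rightarrow> complex" assume "p \<in> Pol m"
      then show "subdiv a (restr (conv_pv p y)) = restr (conv_pv (\<lambda>x. p ((1/2) *\<^sub>R x)) y)"
      proof (induction rule: Pol_induct)
        case zero
        show ?case by (simp add: conv_pv_zero restr_zero subdiv_zero)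
      next
        case (step c \<mu> p)
        then show ?case
          using R unfolding conv_pv_add conv_pv_scale restr_add restr_scale subdiv_add subdiv_scale by simp
      qed
    qed
  qed (use dmono_in_Pol in blast)
  then show ?thesis unfolding matching_iff y_def[symmetric] r by blast
qed

text \<open>Invariance makes every \<open>conv_pv p (ring_seq a v)\<close> of the form
  \<open>conv_pv g v\<close>, so the factorization lemma produces c. The fixed constant serves only
  to normalize it, \<open>fhat c 0 = 1\<close>.\<close>

lemma cond2I_invariant:
  assumes "\<And>p. p \<in> Pol m \<Longrightarrow> subdiv a (restr (conv_pv p v)) \<in> restr ` PolV m v"
    and "subdiv a (\<lambda>_. vhat v 0) = (\<lambda>_. vhat v 0)"
  shows "cond2 m a v"
proof -
  have ex: "\<exists>g\<in>Pol m. subdiv a (restr (conv_pv p v)) = restr (conv_pv g v)" if "p \<in> Pol m" for p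
    using assms(1)[OF that] by (auto simp: PolV_def)
  have ring: "\<exists>g\<in>Pol m. conv_pv p (ring_seq a v) = conv_pv g v" if p: "p \<in> Pol m" for p
  proof -
    \<comment> \<open>Doubling the argument beforehand cancels the halving done by
      subdivision.\<close>
    obtain g where g: "g \<in> Pol m" "subdiv a (restr (conv_pv (\<lambda>x. p (2 *\<^sub>R x)) v)) = restr (conv_pv g v)"
      using ex[OF Pol_dilate[OF p]] by blast
    from subdiv_eq_conv_ring_seq[OF fin_a fin_v Pol_dilate[OF p] conv_pv_vPol[OF g(1)] g(2)] g(1)
    show ?thesis by auto
  qed
  then obtain c where c: "finite (supp c)" "\<And>p. p \<in> Pol m \<Longrightarrow> conv_pv p (ring_seq a v) = conv_pv (conv_pp p c) v"
    using conv_pv_factor[OF fin_v v0, of m "ring_seq a v"] by blast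
  have eq: "subdiv a (restr (conv_pv p v)) = restr (conv_pv (conv_pp (\<lambda>x. p ((1/2) *\<^sub>R x)) c) v)" if p: "p \<in> Pol m" for p
  proof -
    obtain g where g: "g \<in> Pol m" "subdiv a (restr (conv_pv p v)) = restr (conv_pv g v)"
      using ex[OF p] by blast
    from subdiv_eq_conv_ring_seq[OF fin_a fin_v p conv_pv_vPol[OF g(1)] g(2)] g(2) show ?thesis
      unfolding c(2)[OF Pol_dilate[OF p]] by simp
  qed
  have "restr (conv_pv (conv_pp (\<lambda>x. 1) c) v) = restr (conv_pv (\<lambda>x. 1) v)"
    using eq[OF Pol_const, of 1] assms(2) unfolding const_eq_conv_pv by simp
  from fun_cong[OF this, of 0] have "fhat c 0 *s vhat v 0 = vhat v 0"
    by (simp add: restr_def conv_pp_const conv_pv_const[OF fin_v])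
  then have "fhat c 0 = 1" using v0 by (auto simp: vec_eq_iff)
  with c(1) eq show ?thesis unfolding cond2_iff by blast
qed

text \<open>Equality of the spaces, beyond inclusion, holds because dilation and convolution with c
  both map \<open>Pol m\<close> onto itself.\<close>

lemma cond2_imp_1: "cond2 m a v \<Longrightarrow> cond1 m a v"
proof -
  assume "cond2 m a v"
  then obtain c where c: "finite (supp c)" "fhat c 0 = 1"
    and eq: "\<And>p. p \<in> Pol m \<Longrightarrow> subdiv a (restr (conv_pv p v)) = restr (conv_pv (conv_pp (\<lambda>x. p ((1/2) *\<^sub>R x)) c) v)"
    unfolding cond2_iff by blast
  have "subdiv a ` restr ` PolV m v \<subseteq> restr ` PolV m v"
    using eq PolV_I[OF conv_pp_in_Pol[OF Pol_dilate]] by (fastforce simp: PolV_def)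
  moreover have "restr ` PolV m v \<subseteq> subdiv a ` restr ` PolV m v"
  proof
    fix f assume "f \<in> restr ` PolV m v"
    then obtain q where q: "q \<in> Pol m" "f = restr (conv_pv q v)" by (auto simp: PolV_def)
    obtain p where p: "p \<in> Pol m" "conv_pp p c = q" using conv_pp_surj[OF c(2) q(1)] by blast
    have "subdiv a (restr (conv_pv (\<lambda>x. p (2 *\<^sub>R x)) v)) = f"
      using eq[OF Pol_dilate[OF p(1)], of 2] p(2) q(2) by simp
    then show "f \<in> subdiv a ` restr ` PolV m v" using PolV_I[OF Pol_dilate[OF p(1), of 2], of v] by blast
  qed
  moreover have "subdiv a (restr (conv_pv (\<lambda>x. 1) v)) = restr (conv_pv (\<lambda>x. 1) v)"
    using eq[OF Pol_const, of 1] by (simp add: conv_pp_const c(2))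
  ultimately show ?thesis unfolding cond1_def const_eq_conv_pv by blast
qed

lemma cond1_imp_6: "cond1 m a v \<Longrightarrow> cond6 m a v"
  unfolding cond1_def cond6_def using PolV_I[OF dmono_in_Pol] by blast

text \<open>Each lower divided monomial is a derivative of one of degree m, and differentiating the
  equation for the latter keeps its right-hand side in \<open>PolV m v\<close>.\<close>

lemma cond6_imp_2: "cond6 m a v \<Longrightarrow> cond2 m a v"
proof -
  assume 6: "cond6 m a v"
  have dm: "\<exists>g\<in>Pol m. subdiv a (restr (conv_pv (dmono \<mu>) v)) = restr (conv_pv g v)" if \<mu>: "mdeg \<mu> \<le> m" for \<mu>
  proof -
    obtain \<kappa> \<nu> where \<kappa>: "mdeg \<kappa> = m" "mderiv \<nu> (dmono \<kappa>) = dmono \<mu>"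
      using exists_dmono_antiderivative[OF \<mu>] by blast
    obtain g where g: "g \<in> Pol m" "subdiv a (restr (conv_pv (dmono \<kappa>) v)) = restr (conv_pv g v)"
      using 6 \<kappa>(1) unfolding cond6_def PolV_def by blast
    have "dmono \<kappa> \<in> Pol m" using \<kappa>(1) by (intro dmono_in_Pol) simp
    from subdiv_mderiv[OF fin_a fin_v this conv_pv_vPol[OF g(1)] g(2), of \<nu>]
    have "subdiv a (restr (conv_pv (dmono \<mu>) v)) = restr (conv_pv (\<lambda>x. 2 ^ mdeg \<nu> * mderiv \<nu> g x) v)"
      unfolding \<kappa>(2) mderiv_conv_pv[OF smooth_Pol[OF g(1)]] conv_pv_scale .
    moreover have "(\<lambda>x. 2 ^ mdeg \<nu> * mderiv \<nu> g x) \<in> Pol m"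
      by (intro Pol_scale Pol_mono[OF mderiv_in_Pol[OF g(1)]]) simp
    ultimately show ?thesis by blast
  qed
  have "\<exists>g\<in>Pol m. subdiv a (restr (conv_pv p v)) = restr (conv_pv g v)" if "p \<in> Pol m" for p
    using that
  proof (induction rule: Pol_induct)
    case zero
    show ?case by (intro bexI[OF _ Pol_zero]) (simp add: conv_pv_zero restr_zero subdiv_zero)
  next
    case (step c \<mu> p)
    obtain g h where "g \<in> Pol m" "subdiv a (restr (conv_pv (dmono \<mu>) v)) = restr (conv_pv g v)"
      "h \<in> Pol m" "subdiv a (restr (conv_pv p v)) = restr (conv_pv h v)"
      using dm[OF step(1)] step(3) by blast
    then show ?case
      by (intro bexI[of _ "\<lambda>x. c * g x + h x"] Pol_add Pol_scale)
        (simp_all add: conv_pv_add conv_pv_scale restr_add restr_scale subdiv_add subdiv_scale)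
  qed
  then have "subdiv a (restr (conv_pv p v)) \<in> restr ` PolV m v" if "p \<in> Pol m" for p
    using that PolV_I by fastforce
  with 6 show ?thesis by (intro cond2I_invariant) (auto simp: cond6_def)
qed

text \<open>Applying (2) to \<open>conv_pp p b\<close> gives the dilated polynomial convolved with c
  and v; the equation for b turns this into the dilated p convolved with b and v.\<close>

lemma cond2_imp_3: "cond2 m a v \<Longrightarrow> cond3 m a v"
proof -
  assume "cond2 m a v"
  then obtain c where c: "finite (supp c)" "fhat c 0 = 1"
    and eq: "\<And>p. p \<in> Pol m \<Longrightarrow> subdiv a (restr (conv_pv p v)) = restr (conv_pv (conv_pp (\<lambda>x. p ((1/2) *\<^sub>R x)) c) v)"
    unfolding cond2_iff by blast
  obtain b where b: "finite (supp b)" "fhat b 0 = 1"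
    and bc: "\<And>p. p \<in> Pol m \<Longrightarrow> conv_pp (\<lambda>x. conv_pp p b ((1/2) *\<^sub>R x)) c = conv_pp (\<lambda>x. p ((1/2) *\<^sub>R x)) b"
    using exists_refinable_filter[OF c(2), of m] by blast
  have "matching m a v b"
    unfolding matching_iff normalized_def conv_pv_conv_sv[OF b(1) fin_v]
    using b eq[OF conv_pp_in_Pol] bc by simp
  then show ?thesis unfolding cond3_def by blast
qed

lemma cond3_iff_4: "cond3 m a v \<longleftrightarrow> cond4 m a v"
  unfolding cond3_def cond4_def matching_iff_dmono ..

text \<open>The eigenvectors of degree m are the q. Their derivatives contain all convolutions of
  lower divided monomials with \<open>conv_sv b v\<close>, and these span \<open>PolV m v\<close>
  because convolution with b is onto \<open>Pol m\<close>.\<close>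

lemma cond4_imp_5: "cond4 m a v \<Longrightarrow> cond5 m a v"
proof -
  assume "cond4 m a v"
  then obtain b where b: "finite (supp b)" "fhat b 0 = 1"
    and eq: "\<And>\<mu>. mdeg \<mu> \<le> m \<Longrightarrow> subdiv a (restr (conv_pv (dmono \<mu>) (conv_sv b v))) =
      fscale ((1/2) ^ mdeg \<mu>) (restr (conv_pv (dmono \<mu>) (conv_sv b v)))"
    unfolding cond4_def normalized_def by blast
  define q where "q \<mu> = conv_pv (dmono \<mu>) (conv_sv b v)" for \<mu>
  let ?X = "{mderiv \<nu> (q \<mu>) | \<mu> \<nu>. mdeg \<mu> = m}"
  have mq: "mderiv \<nu> (q \<mu>) = conv_pv (mderiv \<nu> (dmono \<mu>)) (conv_sv b v)" for \<nu> \<mu>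
    unfolding q_def by (rule mderiv_conv_pv[OF smooth_dmono])
  have "?X \<subseteq> PolV m v"
  proof
    fix f assume "f \<in> ?X"
    then obtain \<mu> \<nu> where "mdeg \<mu> = m" "f = mderiv \<nu> (q \<mu>)" by blast
    moreover from this have "mderiv \<nu> (dmono \<mu>) \<in> Pol m"
      using Pol_mono[OF mderiv_in_Pol[OF dmono_in_Pol[of \<mu> m]]] by simp
    ultimately show "f \<in> PolV m v"
      unfolding mq conv_pv_conv_sv[OF b(1) fin_v] by (auto intro!: PolV_I conv_pp_in_Pol)
  qed
  then have "fun_vs.span ?X \<subseteq> PolV m v" by (rule fun_vs.span_minimal[OF _ PolV_subspace])
  moreover have "PolV m v \<subseteq> fun_vs.span ?X"
  proof
    fix f assume "f \<in> PolV m v"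
    then obtain p where p: "p \<in> Pol m" "f = conv_pv p v" by (auto simp: PolV_def)
    obtain p' where p': "p' \<in> Pol m" "conv_pp p' b = p" using conv_pp_surj[OF b(2) p(1)] by blast
    have "conv_pv p' (conv_sv b v) \<in> fun_vs.span ?X"
      using p'(1)
    proof (induction rule: Pol_induct)
      case zero
      show ?case using fun_vs.span_zero[of ?X] by (simp add: conv_pv_zero zero_fun_def)
    next
      case (step c \<mu> p)
      obtain \<kappa> \<nu> where \<kappa>: "mdeg \<kappa> = m" "mderiv \<nu> (dmono \<kappa>) = dmono \<mu>"
        using exists_dmono_antiderivative[OF step(1)] by blast
      have "mderiv \<nu> (q \<kappa>) \<in> fun_vs.span ?X" using \<kappa>(1) by (intro fun_vs.span_base) blast
      then have "conv_pv (dmono \<mu>) (conv_sv b v) \<in> fun_vs.span ?X" unfolding mq \<kappa>(2) .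
      moreover have "conv_pv (\<lambda>x. c * dmono \<mu> x + p x) (conv_sv b v) =
          fscale c (conv_pv (dmono \<mu>) (conv_sv b v)) + conv_pv p (conv_sv b v)"
        by (simp add: conv_pv_add conv_pv_scale plus_fun_def fscale_def)
      ultimately show ?case using step(3) by (simp only: fun_vs.span_add fun_vs.span_scale)
    qed
    then show "f \<in> fun_vs.span ?X" using p(2) p'(2) by (simp add: conv_pv_conv_sv[OF b(1) fin_v])
  qed
  moreover have "q \<mu> \<in> vPol m" if "mdeg \<mu> = m" for \<mu>
    using that unfolding q_def by (intro conv_pv_vPol dmono_in_Pol) simp
  moreover have "subdiv a (restr (q \<mu>)) = fscale ((1/2) ^ mdeg \<mu>) (restr (q \<mu>))" if "mdeg \<mu> = m" for \<mu>
    using eq[of \<mu>] that unfolding q_def by simp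
  ultimately show ?thesis unfolding cond5_def by blast
qed

text \<open>Each derivative doubles the eigenvalue, so all generators of the span are eigenvectors
  and the span is invariant. The eigenvalue reaches 1 exactly after m derivatives.\<close>

lemma cond5_imp_6: "cond5 m a v \<Longrightarrow> cond6 m a v"
proof -
  assume "cond5 m a v"
  then obtain q :: "nat ^ 'd \<Rightarrow> real ^ 'd \<Rightarrow> complex ^ 'r" where
    q: "\<And>\<mu>. mdeg \<mu> = m \<Longrightarrow> q \<mu> \<in> vPol m"
      "\<And>\<mu>. mdeg \<mu> = m \<Longrightarrow> subdiv a (restr (q \<mu>)) = fscale ((1/2) ^ m) (restr (q \<mu>))"
    and span: "fun_vs.span {mderiv \<nu> (q \<mu>) | \<mu> \<nu>. mdeg \<mu> = m} = PolV m v"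
    unfolding cond5_def by auto
  let ?X = "{mderiv \<nu> (q \<mu>) | \<mu> \<nu>. mdeg \<mu> = m}"
  have base: "\<exists>g\<in>Pol m. q \<mu> = conv_pv g v" if "mdeg \<mu> = m" for \<mu>
  proof -
    have "q \<mu> = mderiv 0 (q \<mu>)" by (simp add: mderiv_0)
    then have "q \<mu> \<in> ?X" using that by blast
    then have "q \<mu> \<in> PolV m v" using fun_vs.span_base[of "q \<mu>" ?X] span by blast
    then show ?thesis by (auto simp: PolV_def)
  qed
  have eigen: "subdiv a (restr (mderiv \<nu> (q \<mu>))) = restr (\<lambda>x. (2 ^ mdeg \<nu> * (1/2) ^ m) *s mderiv \<nu> (q \<mu>) x)"
    if \<mu>: "mdeg \<mu> = m" for \<mu> \<nu>
  proof -
    obtain g where g: "g \<in> Pol m" "q \<mu> = conv_pv g v" using base[OF \<mu>] by blast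
    have h: "(\<lambda>x. (1/2) ^ m * g x) \<in> Pol m" by (rule Pol_scale[OF g(1)])
    have "subdiv a (restr (conv_pv g v)) = restr (conv_pv (\<lambda>x. (1/2) ^ m * g x) v)"
      using q(2)[OF \<mu>] unfolding g(2) conv_pv_scale restr_scale fscale_def .
    from subdiv_mderiv[OF fin_a fin_v g(1) conv_pv_vPol[OF h] this, of \<nu>] show ?thesis
      unfolding g(2) mderiv_conv_pv[OF smooth_Pol[OF g(1)]] mderiv_conv_pv[OF smooth_Pol[OF h]]
        mderiv_scale[OF smooth_Pol[OF g(1)]]
      unfolding conv_pv_scale by (simp add: vec.scale_scale)
  qed
  have inv: "subdiv a (restr f) \<in> restr ` PolV m v" if "f \<in> PolV m v" for f
    using that unfolding span[symmetric]
  proof (induction rule: fun_vs.span_induct)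
    case base
    show ?case
    proof (rule fun_vs.subspaceI)
      have "0 \<in> PolV m v" by (rule fun_vs.subspace_0[OF PolV_subspace])
      then have "restr 0 \<in> restr ` PolV m v" by (rule imageI)
      then show "0 \<in> {f. subdiv a (restr f) \<in> restr ` fun_vs.span ?X}"
        unfolding span by (simp add: zero_fun_def restr_zero subdiv_zero)
    next
      fix f g assume "f \<in> {f. subdiv a (restr f) \<in> restr ` fun_vs.span ?X}"
        "g \<in> {f. subdiv a (restr f) \<in> restr ` fun_vs.span ?X}"
      then obtain f' g' where *: "f' \<in> PolV m v" "g' \<in> PolV m v" "subdiv a (restr f) = restr f'"
        "subdiv a (restr g) = restr g'" unfolding span by blast
      have "subdiv a (restr (f + g)) = restr (f' + g')"
        unfolding plus_fun_def restr_add subdiv_add *(3,4) ..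
      then show "f + g \<in> {f. subdiv a (restr f) \<in> restr ` fun_vs.span ?X}"
        unfolding span using fun_vs.subspace_add[OF PolV_subspace *(1,2)] by blast
    next
      fix c f assume "f \<in> {f. subdiv a (restr f) \<in> restr ` fun_vs.span ?X}"
      then obtain f' where *: "f' \<in> PolV m v" "subdiv a (restr f) = restr f'" unfolding span by blast
      have "subdiv a (restr (fscale c f)) = restr (fscale c f')"
        unfolding fscale_def restr_scale subdiv_scale *(2) ..
      then show "fscale c f \<in> {f. subdiv a (restr f) \<in> restr ` fun_vs.span ?X}"
        unfolding span using fun_vs.subspace_scale[OF PolV_subspace *(1)] by blast
    qed
  next
    case (step f)
    then obtain \<mu> \<nu> where f: "mdeg \<mu> = m" "f = mderiv \<nu> (q \<mu>)" by blast
    have "f \<in> PolV m v" unfolding span[symmetric] using step by (rule fun_vs.span_base)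
    then have "fscale (2 ^ mdeg \<nu> * (1/2) ^ m) f \<in> PolV m v" by (rule fun_vs.subspace_scale[OF PolV_subspace])
    moreover have "subdiv a (restr f) = restr (fscale (2 ^ mdeg \<nu> * (1/2) ^ m) f)"
      using eigen[OF f(1), of \<nu>] unfolding f(2)[symmetric] fscale_def .
    ultimately show ?case unfolding span by (simp only: imageI)
  qed
  obtain \<kappa> :: "nat ^ 'd" where \<kappa>: "mdeg \<kappa> = m"
    using exists_dmono_antiderivative[of "0 :: nat ^ 'd" m] by (auto simp: mdeg_def)
  \<comment> \<open>The derivative of order \<kappa> of any element of the span is fixed by
    subdivision. It remains to check generators; the constant \<open>vhat v 0\<close> is such a
    derivative, that of \<open>conv_pv (dmono \<kappa>) v\<close>.\<close>
  have top: "smooth f \<and> subdiv a (restr (mderiv \<kappa> f)) = restr (mderiv \<kappa> f)" if "f \<in> PolV m v" for f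
    using that unfolding span[symmetric]
  proof (induction rule: fun_vs.span_induct)
    case base
    show ?case
    proof (rule fun_vs.subspaceI; unfold mem_Collect_eq)
      show "smooth (0 :: real ^ 'd \<Rightarrow> complex ^ 'r) \<and> subdiv a (restr (mderiv \<kappa> 0)) = restr (mderiv \<kappa> 0)"
        by (simp add: zero_fun_def smooth_zero mderiv_zero restr_zero subdiv_zero)
    next
      fix f g assume "smooth f \<and> subdiv a (restr (mderiv \<kappa> f)) = restr (mderiv \<kappa> f)"
        "smooth g \<and> subdiv a (restr (mderiv \<kappa> g)) = restr (mderiv \<kappa> g)"
      then show "smooth (f + g) \<and> subdiv a (restr (mderiv \<kappa> (f + g))) = restr (mderiv \<kappa> (f + g))"
        by (simp add: plus_fun_def smooth_add mderiv_add restr_add subdiv_add)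
    next
      fix c f assume f: "smooth f \<and> subdiv a (restr (mderiv \<kappa> f)) = restr (mderiv \<kappa> f)"
      have L: "bounded_linear (\<lambda>z :: complex ^ 'r. c *s z)"
        unfolding linear_conv_bounded_linear[symmetric] by (rule linearI) (auto simp: vec_eq_iff algebra_simps)
      show "smooth (fscale c f) \<and> subdiv a (restr (mderiv \<kappa> (fscale c f))) = restr (mderiv \<kappa> (fscale c f))"
        using f smooth_linear[OF L conjunct1[OF f]]
        by (simp add: fscale_def mderiv_linear[OF L conjunct1[OF f]] restr_scale subdiv_scale)
    qed
  next
    case (step f)
    then obtain \<mu> \<nu> where f: "mdeg \<mu> = m" "f = mderiv \<nu> (q \<mu>)" by blast
    obtain g where g: "g \<in> Pol m" "q \<mu> = conv_pv g v" using base[OF f(1)] by blast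
    have fg: "f = conv_pv (mderiv \<nu> g) v" unfolding f(2) g(2) by (rule mderiv_conv_pv[OF smooth_Pol[OF g(1)]])
    have sm: "smooth (mderiv \<nu> g)" by (rule smooth_Pol[OF mderiv_in_Pol[OF g(1)]])
    have "subdiv a (restr (mderiv \<kappa> f)) = restr (mderiv \<kappa> f)"
    proof (cases "\<nu> = 0")
      case True
      \<comment> \<open>The eigenvalue is \<open>2 ^ m * (1/2) ^ m = 1\<close>.\<close>
      then show ?thesis using eigen[OF f(1), of \<kappa>] \<kappa> by (simp add: f(2) mderiv_0 flip: power_mult_distrib)
    next
      case False
      \<comment> \<open>More than m derivatives in total annihilate a polynomial of degree at most
        m.\<close>
      have "mderiv \<kappa> (mderiv \<nu> g) = (\<lambda>x. 0)"
      proof (cases "mdeg \<nu> \<le> m")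
        case True
        then have "m - mdeg \<nu> < mdeg \<kappa>" using False \<kappa> mdeg_eq_0[of \<nu>] by simp
        then show ?thesis by (rule mderiv_Pol_eq_0[OF mderiv_in_Pol[OF g(1)]])
      qed (simp add: mderiv_Pol_eq_0[OF g(1)] mderiv_zero)
      then show ?thesis
        unfolding fg mderiv_conv_pv[OF sm] by (simp add: conv_pv_zero restr_zero subdiv_zero)
    qed
    then show ?case using smooth_conv_pv[OF sm] fg by simp
  qed
  have dm: "conv_pv (dmono \<mu>) v \<in> PolV m v" if "mdeg \<mu> = m" for \<mu>
    using that by (intro PolV_I dmono_in_Pol) simp
  have "mderiv \<kappa> (conv_pv (dmono \<kappa>) v) = conv_pv (\<lambda>x. 1) v"
    by (simp add: mderiv_conv_pv[OF smooth_dmono] mderiv_dmono dmono_0)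
  then have "subdiv a (\<lambda>_. vhat v 0) = (\<lambda>_. vhat v 0)"
    unfolding const_eq_conv_pv using top[OF dm[OF \<kappa>]] by simp
  then show ?thesis unfolding cond6_def using inv[OF dm] by blast
qed

text \<open>Two cycles through (2): (2), (1), (6), (2) and (2), (3), (4), (5), (6), (2).\<close>

lemma conditions_equivalent:
  "(cond1 m a v \<longleftrightarrow> cond2 m a v) \<and> (cond2 m a v \<longleftrightarrow> cond3 m a v) \<and> (cond3 m a v \<longleftrightarrow> cond4 m a v) \<and>
   (cond4 m a v \<longleftrightarrow> cond5 m a v) \<and> (cond5 m a v \<longleftrightarrow> cond6 m a v)"
  using cond2_imp_1 cond1_imp_6 cond6_imp_2 cond2_imp_3 cond3_iff_4 cond4_imp_5 cond5_imp_6 by blast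

end

theorem theorem2p3:
  fixes a :: "int ^ 'd::finite \<Rightarrow> complex ^ 'r::finite ^ 'r"
    and v :: "int ^ 'd \<Rightarrow> complex ^ 'r"
    and m :: nat
  assumes "finite (supp a)" and "finite (supp v)" and "vhat v 0 \<noteq> 0"
  shows
   "let mono = (\<lambda>(\<mu>::nat^'d) x. mpow x \<mu> / of_nat (mfact \<mu>));
        filt = (\<lambda>b. finite (supp b) \<and> fhat b 0 = 1);
        matching = (\<lambda>b. filt b \<and> sum_rules (m + 1) a (conv_sv b v));
        P1 = (subdiv a ` restr ` PolV m v = restr ` PolV m v \<and>
              subdiv a (\<lambda>_. vhat v 0) = (\<lambda>_. vhat v 0));
        P2 = (\<exists>c. finite (supp c) \<and> fhat c 0 = 1 \<and>
              eq_order (m + 1) (\<lambda>\<xi>. vhat v (2 *\<^sub>R \<xi>) v* mhat a \<xi>) (\<lambda>\<xi>. fhat c \<xi> *s vhat v \<xi>) \<and>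
              (\<forall>\<omega>\<in>Gam - {0}.
                 eq_order (m + 1) (\<lambda>\<xi>. vhat v (2 *\<^sub>R \<xi>) v* mhat a (\<xi> + pi *\<^sub>R emb \<omega>)) (\<lambda>\<xi>. 0)));
        P3 = (\<exists>b. matching b);
        P4 = (\<exists>b. filt b \<and>
              (\<forall>\<mu>. mdeg \<mu> \<le> m \<longrightarrow>
                 subdiv a (restr (conv_pv (mono \<mu>) (conv_sv b v))) =
                 fscale ((1/2) ^ mdeg \<mu>) (restr (conv_pv (mono \<mu>) (conv_sv b v)))));
        P5 = (\<exists>q :: nat^'d \<Rightarrow> real^'d \<Rightarrow> complex^'r.
              (\<forall>\<mu>. mdeg \<mu> = m \<longrightarrow>
                 q \<mu> \<in> vPol m \<and>
                 subdiv a (restr (q \<mu>)) = fscale ((1/2) ^ mdeg \<mu>) (restr (q \<mu>))) \<and>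
              fun_vs.span {mderiv \<nu> (q \<mu>) | \<mu> \<nu>. mdeg \<mu> = m} = PolV m v);
        P6 = (subdiv a (\<lambda>_. vhat v 0) = (\<lambda>_. vhat v 0) \<and>
              (\<forall>\<mu>. mdeg \<mu> = m \<longrightarrow> subdiv a (restr (conv_pv (mono \<mu>) v)) \<in> restr ` PolV m v))
    in
      (P1 \<longleftrightarrow> P2) \<and> (P2 \<longleftrightarrow> P3) \<and> (P3 \<longleftrightarrow> P4) \<and> (P4 \<longleftrightarrow> P5) \<and> (P5 \<longleftrightarrow> P6) \<and>
      (\<forall>b. filt b \<longrightarrow>
         (\<forall>\<mu> x. conv_pv (mono \<mu>) (conv_sv b v) x =
            (\<Sum>\<nu> | \<nu> \<le> \<mu>.
               ((- \<i>) ^ mdeg \<nu> / of_nat (mfact \<nu> * mfact (\<mu> - \<nu>)) * mpow x (\<mu> - \<nu>))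
               *s mderiv \<nu> (vhat (conv_sv b v)) 0))) \<and>
      (P1 \<or> P2 \<or> P3 \<or> P4 \<or> P5 \<or> P6 \<longrightarrow>
        (\<exists>vr. finite (supp vr) \<and> (\<forall>\<xi>. vhat vr \<xi> = vhat v (2 *\<^sub>R \<xi>) v* mhat a \<xi>) \<and>
           (\<forall>p\<in>Pol m.
              subdiv a (restr (conv_pv p v)) = restr (conv_pm (\<lambda>x. conv_pv p v ((1/2) *\<^sub>R x)) a) \<and>
              conv_pm (\<lambda>x. conv_pv p v ((1/2) *\<^sub>R x)) a = conv_pv (\<lambda>x. p ((1/2) *\<^sub>R x)) vr)) \<and>
        (\<forall>p\<in>Pol m.
           subdiv a (restr (conv_pv p v)) \<in> restr ` vPol m \<and>
           (\<forall>\<nu>. mderiv \<nu> (pol_ext (subdiv a (restr (conv_pv p v)))) =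
                fscale ((1/2) ^ mdeg \<nu>) (pol_ext (subdiv a (restr (conv_pv (mderiv \<nu> p) v)))))) \<and>
        (\<forall>b. matching b \<longrightarrow>
           (\<forall>p\<in>Pol m.
              subdiv a (restr (conv_pv p (conv_sv b v))) =
                restr (conv_pm (\<lambda>x. conv_pv p (conv_sv b v) ((1/2) *\<^sub>R x)) a) \<and>
              conv_pm (\<lambda>x. conv_pv p (conv_sv b v) ((1/2) *\<^sub>R x)) a =
                conv_pv (\<lambda>x. p ((1/2) *\<^sub>R x)) (conv_sv b v) \<and>
              subdiv a (restr (conv_pv p (conv_sv b v))) \<in> restr ` vPol m \<and>
              (\<forall>\<nu>. mderiv \<nu> (pol_ext (subdiv a (restr (conv_pv p (conv_sv b v))))) =
                   fscale ((1/2) ^ mdeg \<nu>)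
                     (pol_ext (subdiv a (restr (conv_pv (mderiv \<nu> p) (conv_sv b v)))))))))"
proof -
  note fin = assms(1,2)
  have part1: "\<forall>b. normalized b \<longrightarrow> (\<forall>\<mu> x. conv_pv (dmono \<mu>) (conv_sv b v) x =
      (\<Sum>\<nu> | \<nu> \<le> \<mu>. ((- \<i>) ^ mdeg \<nu> / of_nat (mfact \<nu> * mfact (\<mu> - \<nu>)) * mpow x (\<mu> - \<nu>))
        *s mderiv \<nu> (vhat (conv_sv b v)) 0))" (is ?P)
  proof (intro allI impI)
    fix b :: "int ^ 'd \<Rightarrow> complex" and \<mu> x assume "normalized b"
    then have "finite (supp (conv_sv b v))"
      unfolding normalized_def using finite_supp_conv_sv assms(2) by blast
    then show "conv_pv (dmono \<mu>) (conv_sv b v) x =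
      (\<Sum>\<nu> | \<nu> \<le> \<mu>. ((- \<i>) ^ mdeg \<nu> / of_nat (mfact \<nu> * mfact (\<mu> - \<nu>)) * mpow x (\<mu> - \<nu>))
        *s mderiv \<nu> (vhat (conv_sv b v)) 0)"
      by (rule conv_pv_dmono)
  qed
  have part2: "\<exists>vr. finite (supp vr) \<and> (\<forall>\<xi>. vhat vr \<xi> = vhat v (2 *\<^sub>R \<xi>) v* mhat a \<xi>) \<and>
      (\<forall>p\<in>Pol m.
        subdiv a (restr (conv_pv p v)) = restr (conv_pm (\<lambda>x. conv_pv p v ((1/2) *\<^sub>R x)) a) \<and>
        conv_pm (\<lambda>x. conv_pv p v ((1/2) *\<^sub>R x)) a = conv_pv (\<lambda>x. p ((1/2) *\<^sub>R x)) vr)" (is ?A)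
    and part3: "\<forall>p\<in>Pol m.
      subdiv a (restr (conv_pv p v)) \<in> restr ` vPol m \<and>
      (\<forall>\<nu>. mderiv \<nu> (pol_ext (subdiv a (restr (conv_pv p v)))) =
        fscale ((1/2) ^ mdeg \<nu>) (pol_ext (subdiv a (restr (conv_pv (mderiv \<nu> p) v)))))" (is ?B)
    if cond2: "cond2 m a v"
  proof -
    \<comment> \<open>The filter c only exhibits some polynomial on the right-hand side; uniqueness
      then identifies it with the convolution with \<open>ring_seq a v\<close>, the witness for
      \<open>vr\<close>.\<close>
    obtain c where c: "\<And>p. p \<in> Pol m \<Longrightarrow>
        subdiv a (restr (conv_pv p v)) = restr (conv_pv (conv_pp (\<lambda>x. p ((1/2) *\<^sub>R x)) c) v)"
      using cond2 unfolding cond2_iff[OF assms] by blast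
    have vP: "conv_pv (conv_pp (\<lambda>x. p ((1/2) *\<^sub>R x)) c) v \<in> vPol m" if "p \<in> Pol m" for p
      by (intro conv_pv_vPol conv_pp_in_Pol Pol_dilate that)
    have "vhat (ring_seq a v) \<xi> = vhat v (2 *\<^sub>R \<xi>) v* mhat a \<xi>" for \<xi>
      using vhat_twist_ring_seq[OF fin, of \<xi> 0] by (simp add: emb_0 twist_0)
    moreover have "subdiv a (restr (conv_pv p v)) = restr (conv_pv (\<lambda>x. p ((1/2) *\<^sub>R x)) (ring_seq a v))"
      if "p \<in> Pol m" for p
      unfolding subdiv_eq_conv_ring_seq[OF fin that vP[OF that] c[OF that]] by (rule c[OF that])
    ultimately show ?A
      by (intro exI[of _ "ring_seq a v"]) (simp add: finite_supp_ring_seq[OF fin] conv_pm_conv_pv[OF fin])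
    show ?B
    proof
      fix p :: "real ^ 'd \<Rightarrow> complex" assume p: "p \<in> Pol m"
      show "subdiv a (restr (conv_pv p v)) \<in> restr ` vPol m \<and>
          (\<forall>\<nu>. mderiv \<nu> (pol_ext (subdiv a (restr (conv_pv p v)))) =
            fscale ((1/2) ^ mdeg \<nu>) (pol_ext (subdiv a (restr (conv_pv (mderiv \<nu> p) v)))))"
        using mderiv_pol_ext_subdiv[OF fin p vP[OF p] c[OF p]] by simp
    qed
  qed
  have part4: "\<forall>b. matching m a v b \<longrightarrow>
      (\<forall>p\<in>Pol m.
        subdiv a (restr (conv_pv p (conv_sv b v))) =
          restr (conv_pm (\<lambda>x. conv_pv p (conv_sv b v) ((1/2) *\<^sub>R x)) a) \<and>
        conv_pm (\<lambda>x. conv_pv p (conv_sv b v) ((1/2) *\<^sub>R x)) a =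
          conv_pv (\<lambda>x. p ((1/2) *\<^sub>R x)) (conv_sv b v) \<and>
        subdiv a (restr (conv_pv p (conv_sv b v))) \<in> restr ` vPol m \<and>
        (\<forall>\<nu>. mderiv \<nu> (pol_ext (subdiv a (restr (conv_pv p (conv_sv b v))))) =
          fscale ((1/2) ^ mdeg \<nu>)
            (pol_ext (subdiv a (restr (conv_pv (mderiv \<nu> p) (conv_sv b v)))))))" (is ?C)
  proof (intro allI impI ballI)
    fix b and p :: "real ^ 'd \<Rightarrow> complex" assume b: "matching m a v b" and p: "p \<in> Pol m"
    let ?y = "conv_sv b v"
    have y: "finite (supp ?y)"
      and eq: "subdiv a (restr (conv_pv p ?y)) = restr (conv_pv (\<lambda>x. p ((1/2) *\<^sub>R x)) ?y)"
      using b p assms(2) unfolding matching_iff[OF assms] normalized_def by (simp_all add: finite_supp_conv_sv)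
    have vP: "conv_pv (\<lambda>x. p ((1/2) *\<^sub>R x)) ?y \<in> vPol m" by (rule conv_pv_vPol[OF Pol_dilate[OF p]])
    have conv: "conv_pm (\<lambda>x. conv_pv p ?y ((1/2) *\<^sub>R x)) a = conv_pv (\<lambda>x. p ((1/2) *\<^sub>R x)) ?y"
      unfolding conv_pm_conv_pv[OF assms(1) y] by (rule subdiv_eq_conv_ring_seq[OF assms(1) y p vP eq])
    note der = mderiv_pol_ext_subdiv[OF assms(1) y p vP eq]
    show "subdiv a (restr (conv_pv p ?y)) = restr (conv_pm (\<lambda>x. conv_pv p ?y ((1/2) *\<^sub>R x)) a) \<and>
        conv_pm (\<lambda>x. conv_pv p ?y ((1/2) *\<^sub>R x)) a = conv_pv (\<lambda>x. p ((1/2) *\<^sub>R x)) ?y \<and>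
        subdiv a (restr (conv_pv p ?y)) \<in> restr ` vPol m \<and>
        (\<forall>\<nu>. mderiv \<nu> (pol_ext (subdiv a (restr (conv_pv p ?y)))) =
          fscale ((1/2) ^ mdeg \<nu>) (pol_ext (subdiv a (restr (conv_pv (mderiv \<nu> p) ?y)))))"
      using eq conv der by simp
  qed
  note equiv = conditions_equivalent[OF assms]
  have dmono: "dmono = (\<lambda>(\<mu>::nat^'d) x. mpow x \<mu> / of_nat (mfact \<mu>))"
    by (simp add: fun_eq_iff dmono_def)
  have "cond1 m a v \<or> cond2 m a v \<or> cond3 m a v \<or> cond4 m a v \<or> cond5 m a v \<or> cond6 m a v \<longrightarrow> ?A \<and> ?B \<and> ?C"
  proof
    assume "cond1 m a v \<or> cond2 m a v \<or> cond3 m a v \<or> cond4 m a v \<or> cond5 m a v \<or> cond6 m a v"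
    then have "cond2 m a v" using equiv by blast
    then show "?A \<and> ?B \<and> ?C" by (intro conjI part2 part3 part4)
  qed
  with equiv part1 have "(cond1 m a v \<longleftrightarrow> cond2 m a v) \<and> (cond2 m a v \<longleftrightarrow> cond3 m a v) \<and> (cond3 m a v \<longleftrightarrow> cond4 m a v) \<and>
      (cond4 m a v \<longleftrightarrow> cond5 m a v) \<and> (cond5 m a v \<longleftrightarrow> cond6 m a v) \<and> ?P \<and>
      (cond1 m a v \<or> cond2 m a v \<or> cond3 m a v \<or> cond4 m a v \<or> cond5 m a v \<or> cond6 m a v \<longrightarrow> ?A \<and> ?B \<and> ?C)"
    by (simp only: simp_thms)
  then show ?thesis
    unfolding Let_def cond1_def cond2_def cond3_def cond4_def cond5_def cond6_def matching_def normalized_def dmono .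
qed

end
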